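(* Let $\mathcal{X},\mathcal{Y}$ be finite dimensional Euclidean spaces, $\theta:\mathcal{X}\to(-\infty,\infty]$ a closed proper convex function with Fenchel conjugate $\theta^*$, $\mathcal{Q}:\mathcal{X}\to\mathcal{X}$ a self-adjoint positive semidefinite linear operator, $c\in\mathcal{X}$, $b\in\mathcal{Y}$, and $\mathcal{A}:\mathcal{X}\to\mathcal{Y}$ a surjective linear map such that there exists $x\in\operatorname{ri}(\operatorname{dom}\theta^* )$ with $\mathcal{A}x=b$. Consider the problem $$\min_{x\in\mathcal{X}}\ \Big\{\theta^*(x)+\tfrac12\langle x,\mathcal{Q}x\rangle+\langle c,x\rangle\ :\ \mathcal{A}x=b\Big\}\qquad(\mathrm{P})$$ and its dual in minimization form $$\min_{w\in\mathcal{X},\,y\in\mathcal{Y},\,z\in\mathcal{X}}\ \Big\{\tfrac12\langle w,\mathcal{Q}w\rangle-\langle b,y\rangle+\theta(-z)\ :\ -\mathcal{Q}w+\mathcal{A}^*y+z=c\Big\}.\qquad(\mathrm{D})$$ Suppose that the solution set of (P) is nonempty. Let $\sigma\in\left(0,\frac{2}{\lambda_{\max}(\mathcal{Q})}\right)$ and $\rho\in\left(0,\frac{4-\sigma\lambda_{\max}(\mathcal{Q})}{2}\right)$. Then infinite sequences $\{w^k\},\{y^k\},\{z^k\},\{x^k\}$ can be generated by the generalized modified ADMM described in the context (that is, all of its subproblems are solvable), the sequence $\{(w^k,y^k,z^k)\}$ converges to a solution of (D), and the sequence $\{x^k\}$ converges to a solution of (P).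
   Context: Each of $\mathcal{X},\mathcal{Y}$ carries an inner product $\langle\cdot,\cdot\rangle$ with induced norm $\|\cdot\|$; $\mathcal{A}^*$ is the adjoint of $\mathcal{A}$; $\operatorname{ri}$ denotes relative interior and $\operatorname{dom}$ effective domain; $\lambda_{\max}(\mathcal{Q})$ is the largest eigenvalue of $\mathcal{Q}$, and $2/\lambda_{\max}(\mathcal{Q})$ is read as $+\infty$ if $\mathcal{Q}=0$. For $\sigma>0$ the augmented Lagrangian of (D) is $$\mathcal{L}_\sigma(w,y,z;x):=\tfrac12\langle w,\mathcal{Q}w\rangle-\langle b,y\rangle+\theta(-z)+\langle\mathcal{A}^*y+z-\mathcal{Q}w-c,x\rangle+\tfrac\sigma2\|\mathcal{A}^*y+z-\mathcal{Q}w-c\|^2.$$ Generalized modified ADMM: given $\sigma>0$, $\rho\in(0,2)$, $z^0$ with $-z^0\in\operatorname{dom}\theta$, and $x^0\in\mathcal{X}$, for $k=0,1,\ldots$: Step 1: $w^{k+1}:=x^k$; Step 2: $y^{k+1}:=\operatorname{argmin}_{y\in\mathcal{Y}}\mathcal{L}_\sigma(w^{k+1},y,z^k;x^k)$; Step 3: $z^{k+1}:=\operatorname{argmin}_{z\in\mathcal{X}}\{\theta(-z)+\langle z,x^k\rangle+\frac\sigma2\|\rho\mathcal{A}^*y^{k+1}-(1-\rho)z^k+z-\rho\mathcal{Q}w^{k+1}-\rho c\|^2\}$; Step 4: $x^{k+1}:=x^k+\sigma(\rho\mathcal{A}^*y^{k+1}-(1-\rho)z^k+z^{k+1}-\rho\mathcal{Q}w^{k+1}-\rho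 c)$. *)

theory Defs
  imports "HOL-Analysis.Analysis"
begin

(* The space X is a type of class euclidean_space, hence of dimension at least 1 (so that a largest
   eigenvalue exists). The space Y is only required to be a real inner product space: it is the
   image of X under the surjective linear map A and thus finite dimensional, and this also allows
   the zero space, i.e. a problem without equality constraints. *)

definition effective_domain :: "('a \<Rightarrow> ereal) \<Rightarrow> 'a set" where
  "effective_domain f = {x. f x < \<infinity>}"

(* Convexity and closedness of extended-valued functions are those of the epigraph in X x R. *)

definition ereal_epigraph :: "('a \<Rightarrow> ereal) \<Rightarrow> ('a \<times> real) set" where
  "ereal_epigraph f = {(x, t). f x \<le> ereal t}"

definition closed_proper_convex :: "('a::euclidean_space \<Rightarrow> ereal) \<Rightarrow> bool" where
  "closed_proper_convex f \<longleftrightarrow>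
     (\<forall>x. f x \<noteq> -\<infinity>) \<and> effective_domain f \<noteq> {} \<and>
     convex (ereal_epigraph f) \<and> closed (ereal_epigraph f)"

definition fenchel_conjugate :: "('a::real_inner \<Rightarrow> ereal) \<Rightarrow> 'a \<Rightarrow> ereal" where
  "fenchel_conjugate f x = (SUP u. ereal (x \<bullet> u) - f u)"

definition eigenvalues :: "('a::real_vector \<Rightarrow> 'a) \<Rightarrow> real set" where
  "eigenvalues Q = {l. \<exists>v. v \<noteq> 0 \<and> Q v = l *\<^sub>R v}"

definition lambda_max :: "('a::real_vector \<Rightarrow> 'a) \<Rightarrow> real" where
  "lambda_max Q = Max (eigenvalues Q)"

definition sigma_bound :: "('a::real_vector \<Rightarrow> 'a) \<Rightarrow> ereal" where
  "sigma_bound Q = (if Q = (\<lambda>_. 0) then \<infinity> else ereal (2 / lambda_max Q))"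

(* A solution of the problem of minimizing f over S is a minimizer with finite objective value;
   a point where f is infinite counts as infeasible. *)

definition solution_set :: "('a \<Rightarrow> ereal) \<Rightarrow> 'a set \<Rightarrow> 'a set" where
  "solution_set f S = {x. f x < \<infinity> \<and> is_arg_min f (\<lambda>u. u \<in> S) x}"

definition primal_objective ::
  "('a::real_inner \<Rightarrow> ereal) \<Rightarrow> ('a \<Rightarrow> 'a) \<Rightarrow> 'a \<Rightarrow> 'a \<Rightarrow> ereal" where
  "primal_objective \<theta> Q c x = fenchel_conjugate \<theta> x + ereal (1/2 * (x \<bullet> Q x)) + ereal (c \<bullet> x)"

definition primal_solutions ::
  "('a::real_inner \<Rightarrow> ereal) \<Rightarrow> ('a \<Rightarrow> 'a) \<Rightarrow> ('a \<Rightarrow> 'b) \<Rightarrow> 'b \<Rightarrow> 'a \<Rightarrow> 'a set" where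
  "primal_solutions \<theta> Q A b c = solution_set (primal_objective \<theta> Q c) {x. A x = b}"

definition dual_objective ::
  "('a::real_inner \<Rightarrow> ereal) \<Rightarrow> ('a \<Rightarrow> 'a) \<Rightarrow> 'b::real_inner \<Rightarrow> 'a \<times> 'b \<times> 'a \<Rightarrow> ereal" where
  "dual_objective \<theta> Q b = (\<lambda>(w, y, z). ereal (1/2 * (w \<bullet> Q w)) - ereal (b \<bullet> y) + \<theta> (- z))"

definition dual_solutions ::
  "('a::real_inner \<Rightarrow> ereal) \<Rightarrow> ('a \<Rightarrow> 'a) \<Rightarrow> ('a \<Rightarrow> 'b::real_inner) \<Rightarrow> 'b \<Rightarrow> 'a \<Rightarrow>
     ('a \<times> 'b \<times> 'a) set" where
  "dual_solutions \<theta> Q A b c =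
     solution_set (dual_objective \<theta> Q b) {(w, y, z). - Q w + adjoint A y + z = c}"

definition aug_lagrangian ::
  "('a::real_inner \<Rightarrow> ereal) \<Rightarrow> ('a \<Rightarrow> 'a) \<Rightarrow> ('a \<Rightarrow> 'b::real_inner) \<Rightarrow> 'b \<Rightarrow> 'a \<Rightarrow> real \<Rightarrow>
     'a \<Rightarrow> 'b \<Rightarrow> 'a \<Rightarrow> 'a \<Rightarrow> ereal" where
  "aug_lagrangian \<theta> Q A b c \<sigma> w y z x =
     ereal (1/2 * (w \<bullet> Q w)) - ereal (b \<bullet> y) + \<theta> (- z)
     + ereal ((adjoint A y + z - Q w - c) \<bullet> x)
     + ereal (\<sigma>/2 * (norm (adjoint A y + z - Q w - c))\<^sup>2)"

definition y_minimizer ::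
  "('a::real_inner \<Rightarrow> ereal) \<Rightarrow> ('a \<Rightarrow> 'a) \<Rightarrow> ('a \<Rightarrow> 'b::real_inner) \<Rightarrow> 'b \<Rightarrow> 'a \<Rightarrow> real \<Rightarrow>
     'a \<Rightarrow> 'a \<Rightarrow> 'a \<Rightarrow> 'b \<Rightarrow> bool" where
  "y_minimizer \<theta> Q A b c \<sigma> w z x =
     is_arg_min (\<lambda>y. aug_lagrangian \<theta> Q A b c \<sigma> w y z x) (\<lambda>_. True)"

definition relaxed_residual ::
  "('a::real_inner \<Rightarrow> 'a) \<Rightarrow> ('a \<Rightarrow> 'b::real_inner) \<Rightarrow> 'a \<Rightarrow> real \<Rightarrow> 'a \<Rightarrow> 'b \<Rightarrow> 'a \<Rightarrow> 'a \<Rightarrow> 'a" where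
  "relaxed_residual Q A c \<rho> w y zold z =
     \<rho> *\<^sub>R adjoint A y - (1 - \<rho>) *\<^sub>R zold + z - \<rho> *\<^sub>R Q w - \<rho> *\<^sub>R c"

definition z_minimizer ::
  "('a::real_inner \<Rightarrow> ereal) \<Rightarrow> ('a \<Rightarrow> 'a) \<Rightarrow> ('a \<Rightarrow> 'b::real_inner) \<Rightarrow> 'a \<Rightarrow> real \<Rightarrow> real \<Rightarrow>
     'a \<Rightarrow> 'b \<Rightarrow> 'a \<Rightarrow> 'a \<Rightarrow> 'a \<Rightarrow> bool" where
  "z_minimizer \<theta> Q A c \<sigma> \<rho> w y zold x =
     is_arg_min (\<lambda>z. \<theta> (- z) + ereal (z \<bullet> x)
         + ereal (\<sigma>/2 * (norm (relaxed_residual Q A c \<rho> w y zold z))\<^sup>2)) (\<lambda>_. True)"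

(* The sequences follow the generalized modified ADMM through its first n iterations, where each
   assignment by argmin picks some minimizer. Only w k, y k with k > 0 are meaningful;
   w 0 and y 0 are arbitrary. *)

definition gmadmm_upto ::
  "nat \<Rightarrow> ('a::real_inner \<Rightarrow> ereal) \<Rightarrow> ('a \<Rightarrow> 'a) \<Rightarrow> ('a \<Rightarrow> 'b::real_inner) \<Rightarrow> 'b \<Rightarrow> 'a \<Rightarrow>
     real \<Rightarrow> real \<Rightarrow> 'a \<Rightarrow> 'a \<Rightarrow> (nat \<Rightarrow> 'a) \<Rightarrow> (nat \<Rightarrow> 'b) \<Rightarrow> (nat \<Rightarrow> 'a) \<Rightarrow> (nat \<Rightarrow> 'a) \<Rightarrow> bool" where
  "gmadmm_upto n \<theta> Q A b c \<sigma> \<rho> z0 x0 w y z x \<longleftrightarrow>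
     z 0 = z0 \<and> x 0 = x0 \<and>
     (\<forall>k<n. w (Suc k) = x k \<and>
            y_minimizer \<theta> Q A b c \<sigma> (w (Suc k)) (z k) (x k) (y (Suc k)) \<and>
            z_minimizer \<theta> Q A c \<sigma> \<rho> (w (Suc k)) (y (Suc k)) (z k) (x k) (z (Suc k)) \<and>
            x (Suc k) = x k + \<sigma> *\<^sub>R relaxed_residual Q A c \<rho> (w (Suc k)) (y (Suc k)) (z k) (z (Suc k)))"

definition gmadmm ::
  "('a::real_inner \<Rightarrow> ereal) \<Rightarrow> ('a \<Rightarrow> 'a) \<Rightarrow> ('a \<Rightarrow> 'b::real_inner) \<Rightarrow> 'b \<Rightarrow> 'a \<Rightarrow>
     real \<Rightarrow> real \<Rightarrow> 'a \<Rightarrow> 'a \<Rightarrow> (nat \<Rightarrow> 'a) \<Rightarrow> (nat \<Rightarrow> 'b) \<Rightarrow> (nat \<Rightarrow> 'a) \<Rightarrow> (nat \<Rightarrow> 'a) \<Rightarrow> bool" where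
  "gmadmm \<theta> Q A b c \<sigma> \<rho> z0 x0 w y z x \<longleftrightarrow> (\<forall>n. gmadmm_upto n \<theta> Q A b c \<sigma> \<rho> z0 x0 w y z x)"

end

theory Submission
  imports Defs
begin

text \<open>Put \<open>u = x - \<sigma> z\<close> and \<open>v = x + \<sigma> (A\<^sup>* y + z - Q x - c)\<close>, where \<open>y\<close> is the next
  \<open>y\<close>-iterate. The optimality condition of the \<open>y\<close>-step says \<open>A v = b\<close>, that of the \<open>z\<close>-step says
  \<open>x \<in> \<partial>\<theta> (- z)\<close> for the new pair \<open>x, z\<close>, and the update becomes \<open>u + \<rho> (v - x)\<close>: this is
  relaxed Davis--Yin splitting applied to (P). For a KKT point with \<open>u' = x' - \<sigma> z'\<close>, monotonicity
  of \<open>\<partial>\<theta>\<close> and \<open>\<langle>e + d/2, Q (e + d/2)\<rangle> \<ge> 0\<close> with \<open>e = x - x'\<close>, \<open>d = v - x\<close> show that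
  \<open>\<parallel>u - u'\<parallel>\<^sup>2\<close> drops by at least \<open>\<rho> (2 - \<sigma> \<lambda>\<^sub>m\<^sub>a\<^sub>x / 2 - \<rho>) \<parallel>v - x\<parallel>\<^sup>2\<close> in each step. Hence
  \<open>v - x \<rightarrow> 0\<close>, cluster points are KKT points, and Fejer monotonicity gives convergence of the
  whole sequence. A KKT point exists by separating the epigraph of the linearized primal objective
  from the constraint set.\<close>

section \<open>Linear operators\<close>

text \<open>\<open>adjoint\<close> is a choice operator, so its identity holds once some map
  satisfies it; expanding \<open>x\<close> in the basis of the domain produces one. The codomain can
  thus be any inner product space.\<close>

lemma adjoint_inner:
  fixes f :: "'a::euclidean_space \<Rightarrow> 'b::real_inner"
  assumes "linear f"
  shows "f x \<bullet> y = x \<bullet> adjoint f y"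
proof -
  interpret f: linear f by fact
  define g where "g y = (\<Sum>i\<in>Basis. (f i \<bullet> y) *\<^sub>R i)" for y
  have "f x \<bullet> y = x \<bullet> g y" for x y
  proof -
    have "f x \<bullet> y = f (\<Sum>i\<in>Basis. (x \<bullet> i) *\<^sub>R i) \<bullet> y"
      by (simp add: euclidean_representation)
    also have "\<dots> = (\<Sum>i\<in>Basis. (x \<bullet> i) * (f i \<bullet> y))"
      by (simp add: f.sum f.scaleR inner_sum_left)
    also have "\<dots> = x \<bullet> g y"
      by (simp add: g_def inner_sum_right mult.commute)
    finally show ?thesis .
  qed
  then have "\<exists>g. \<forall>x y. f x \<bullet> y = x \<bullet> g y"
    by blast
  then have "\<forall>x y. f x \<bullet> y = x \<bullet> adjoint f y"
    unfolding adjoint_def by (rule someI_ex)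
  then show ?thesis by blast
qed

lemma linear_adjoint:
  fixes f :: "'a::euclidean_space \<Rightarrow> 'b::real_inner"
  assumes "linear f"
  shows "linear (adjoint f)"
proof (rule linearI)
  note adj = adjoint_inner[OF assms, symmetric]
  show "adjoint f (x + y) = adjoint f x + adjoint f y" for x y
    by (rule vector_eq_rdot[THEN iffD1], rule allI)
       (simp add: inner_commute[of "adjoint f _"] inner_commute[of "_ + _"] adj inner_right_distrib)
  show "adjoint f (r *\<^sub>R x) = r *\<^sub>R adjoint f x" for r x
    by (rule vector_eq_ldot[THEN iffD1], rule allI) (simp add: adj)
qed

text \<open>In the splitting of \<open>p\<close> along the range of \<open>adjoint f\<close>, the
  orthogonal part \<open>z\<close> lies in the kernel because
  \<open>f z \<bullet> f z = z \<bullet> adjoint f (f z)\<close>. Hence \<open>z\<close> is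
  orthogonal to \<open>p\<close>, and so to itself.\<close>

lemma orthogonal_kernel_imp_range_adjoint:
  fixes f :: "'a::euclidean_space \<Rightarrow> 'b::real_inner"
  assumes f: "linear f" and p: "\<And>h. f h = 0 \<Longrightarrow> p \<bullet> h = 0"
  shows "p \<in> range (adjoint f)"
proof -
  have sub: "subspace (range (adjoint f))"
    by (rule linear_subspace_image[OF linear_adjoint[OF f] subspace_UNIV])
  obtain s z where s: "s \<in> range (adjoint f)" and z: "\<And>w. w \<in> range (adjoint f) \<Longrightarrow> orthogonal z w"
    and p_eq: "p = s + z"
    using orthogonal_subspace_decomp_exists[of "range (adjoint f)" p] sub
    by (metis span_eq_iff)
  have "f z \<bullet> f z = 0"
    using z[of "adjoint f (f z)"] by (simp add: adjoint_inner[OF f] orthogonal_def)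
  then have fz: "f z = 0" by simp
  have "z \<bullet> z = 0"
    using p[OF fz] z[OF s] by (simp add: p_eq inner_add_left orthogonal_def inner_commute[of s z])
  then show ?thesis using s p_eq by simp
qed

text \<open>The component of a preimage of \<open>r\<close> orthogonal to the range of
  \<open>adjoint f\<close> lies in the kernel, so the component inside that range is a preimage too.
  This solves the normal equations of the \<open>y\<close>-step.\<close>

lemma surj_adjoint:
  fixes f :: "'a::euclidean_space \<Rightarrow> 'b::real_inner"
  assumes f: "linear f" and "surj f"
  shows "\<exists>y. f (adjoint f y) = r"
proof -
  interpret f: linear f by fact
  obtain x where x: "f x = r" using \<open>surj f\<close> by (metis surjD)
  have sub: "subspace (range (adjoint f))"
    by (rule linear_subspace_image[OF linear_adjoint[OF f] subspace_UNIV])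
  obtain s z where s: "s \<in> range (adjoint f)" and z: "\<And>w. w \<in> range (adjoint f) \<Longrightarrow> orthogonal z w"
    and x_eq: "x = s + z"
    using orthogonal_subspace_decomp_exists[of "range (adjoint f)" x] sub
    by (metis span_eq_iff)
  have "f z \<bullet> f z = 0"
    using z[of "adjoint f (f z)"] by (simp add: adjoint_inner[OF f] orthogonal_def)
  then have "f s = r" using x by (simp add: x_eq f.add)
  then show ?thesis using s by auto
qed

text \<open>On the range of \<open>adjoint f\<close> the map \<open>f\<close> is injective, so
  compactness of the unit sphere there gives a bound \<open>m\<close>. Duality transfers it: write
  \<open>y = f s\<close> with \<open>s\<close> in that range and apply Cauchy-Schwarz to
  \<open>s \<bullet> adjoint f y\<close>. Compactness is taken in the domain, whose type provides
  finite dimension.\<close>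

lemma bounded_below_adjoint:
  fixes f :: "'a::euclidean_space \<Rightarrow> 'b::real_inner"
  assumes f: "linear f" and "surj f"
  shows "\<exists>m>0. \<forall>y. m * norm y \<le> norm (adjoint f y)"
proof -
  interpret f: linear f by fact
  define S where "S = range (adjoint f)"
  have sub: "subspace S"
    unfolding S_def by (rule linear_subspace_image[OF linear_adjoint[OF f] subspace_UNIV])
  have inj: "s = 0" if "s \<in> S" "f s = 0" for s
  proof -
    obtain y where y: "s = adjoint f y" using \<open>s \<in> S\<close> by (auto simp: S_def)
    have "s \<bullet> s = f s \<bullet> y" by (simp add: adjoint_inner[OF f] y)
    then show ?thesis using that by simp
  qed
  have "\<exists>m>0. \<forall>s\<in>S. m * norm s \<le> norm (f s)"
  \<comment> \<open>The range is trivial when the codomain is the zero space; there is then no unit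
    vector to minimize over, and the constant 1 works.\<close>
  proof (cases "S \<inter> sphere 0 1 = {}")
    case True
    have "s = 0" if "s \<in> S" for s
    proof (rule ccontr)
      assume "s \<noteq> 0"
      then have "(1 / norm s) *\<^sub>R s \<in> S \<inter> sphere 0 1"
        using subspace_scale[OF sub that] by simp
      then show False using True by blast
    qed
    then have "\<forall>s\<in>S. 1 * norm s \<le> norm (f s)" by (metis norm_zero mult_1 norm_ge_zero)
    then show ?thesis by (intro exI[of _ 1]) simp
  next
    case False
    have "compact (S \<inter> sphere 0 1)"
      by (intro closed_Int_compact closed_subspace sub) auto
    moreover have "continuous_on (S \<inter> sphere 0 1) (\<lambda>s. norm (f s))"
      by (intro continuous_intros linear_continuous_on)
        (use f in \<open>simp add: linear_conv_bounded_linear\<close>)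
    ultimately obtain a where a: "a \<in> S \<inter> sphere 0 1"
      and min: "\<And>s. s \<in> S \<inter> sphere 0 1 \<Longrightarrow> norm (f a) \<le> norm (f s)"
      using continuous_attains_inf[OF _ False] by blast
    show ?thesis
    proof (intro exI conjI ballI)
      show "0 < norm (f a)" using inj[of a] a by auto
      show "norm (f a) * norm s \<le> norm (f s)" if "s \<in> S" for s
      proof (cases "s = 0")
        case False
        then have "(1 / norm s) *\<^sub>R s \<in> S \<inter> sphere 0 1"
          using subspace_scale[OF sub that] by simp
        from min[OF this] show ?thesis using False
          by (simp add: f.scaleR field_simps)
      qed (simp add: f.zero)
    qed
  qed
  then obtain m where m: "m > 0" "\<And>s. s \<in> S \<Longrightarrow> m * norm s \<le> norm (f s)" by blast
  have "m * norm y \<le> norm (adjoint f y)" for y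
  proof (cases "y = 0")
    case False
    obtain u where u: "f (adjoint f u) = y" using surj_adjoint[OF assms] by blast
    define s where "s = adjoint f u"
    have "m * (norm y)\<^sup>2 = m * (s \<bullet> adjoint f y)"
      using adjoint_inner[OF f, of s y] u by (simp add: s_def dot_square_norm)
    also have "\<dots> \<le> m * (norm s * norm (adjoint f y))"
      using m(1) norm_cauchy_schwarz by (intro mult_left_mono) auto
    also have "\<dots> \<le> norm y * norm (adjoint f y)"
      using mult_right_mono[OF m(2)[of s], of "norm (adjoint f y)"] u
      by (simp add: s_def S_def mult.assoc)
    finally show ?thesis using False by (simp add: power2_eq_square)
  qed (use linear_0[OF linear_adjoint[OF f]] in auto)
  then show ?thesis using m(1) by blast
qed

text \<open>Along \<open>v - t *\<^sub>R Q v\<close> the form is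
  \<open>t\<^sup>2 * B - 2 * t * (norm (Q v))\<^sup>2\<close>, which stays nonnegative only if the
  linear coefficient vanishes.\<close>

lemma psd_form_zero:
  fixes Q :: "'a::real_inner \<Rightarrow> 'a"
  assumes "linear Q" and sym: "\<And>u v. Q u \<bullet> v = u \<bullet> Q v" and psd: "\<And>u. 0 \<le> u \<bullet> Q u"
    and "v \<bullet> Q v = 0"
  shows "Q v = 0"
proof -
  interpret Q: linear Q by fact
  define B where "B = Q v \<bullet> Q (Q v)"
  have B: "0 \<le> B" unfolding B_def by (rule psd)
  have *: "2 * t * (norm (Q v))\<^sup>2 \<le> t\<^sup>2 * B" for t
  proof -
    have "(v - t *\<^sub>R Q v) \<bullet> Q (v - t *\<^sub>R Q v) = t\<^sup>2 * B - 2 * t * (norm (Q v))\<^sup>2"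
      using assms(4) sym[of v "Q v"]
      by (simp add: Q.diff Q.scaleR inner_diff_left inner_diff_right B_def power2_eq_square
          dot_square_norm algebra_simps)
    then show ?thesis using psd[of "v - t *\<^sub>R Q v"] by linarith
  qed
  have "(norm (Q v))\<^sup>2 \<le> 0"
  proof (cases "B = 0")
    case True
    then show ?thesis using *[of 1] by simp
  next
    case False
    let ?N = "(norm (Q v))\<^sup>2"
    \<comment> \<open>The value \<open>?N / B\<close> of \<open>t\<close> minimizes
      \<open>t\<^sup>2 * B - 2 * t * ?N\<close>.\<close>
    have "2 * (?N / B) * ?N \<le> (?N / B)\<^sup>2 * B" by (rule *)
    then have "?N * ?N \<le> 0" using False B by (simp add: power2_eq_square field_simps)
    then show ?thesis by (smt (verit) mult_le_0_iff)
  qed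
  then show ?thesis by simp
qed

section \<open>Spectral bound for symmetric operators\<close>

lemma finite_eigenvalues:
  fixes Q :: "'a::euclidean_space \<Rightarrow> 'a"
  assumes sym: "\<And>u v. Q u \<bullet> v = u \<bullet> Q v"
  shows "finite (eigenvalues Q)"
proof -
  define e where "e l = (SOME v. v \<noteq> 0 \<and> Q v = l *\<^sub>R v)" for l
  have e: "e l \<noteq> 0" "Q (e l) = l *\<^sub>R e l" if "l \<in> eigenvalues Q" for l
    using someI_ex[of "\<lambda>v. v \<noteq> 0 \<and> Q v = l *\<^sub>R v"] that by (auto simp: e_def eigenvalues_def)
  have orth: "e l \<bullet> e m = 0" if "l \<in> eigenvalues Q" "m \<in> eigenvalues Q" "l \<noteq> m" for l m
    using sym[of "e l" "e m"] e that by simp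
  have "inj_on e (eigenvalues Q)"
    by (rule inj_onI) (metis orth e(1) inner_eq_zero_iff)
  moreover have "independent (e ` eigenvalues Q)"
    by (rule pairwise_orthogonal_independent)
      (auto simp: pairwise_def orthogonal_def dest: e(1) intro!: orth)
  ultimately show ?thesis
    using independent_imp_finite finite_imageD by blast
qed

text \<open>Let \<open>v\<close> maximize the form on the unit sphere, with value \<open>l\<close>.
  Then \<open>R\<close>, which is \<open>l\<close> times the identity minus \<open>Q\<close>, is
  positive semidefinite with form zero at \<open>v\<close>, so \<open>psd_form_zero\<close> makes
  \<open>v\<close> an eigenvector for \<open>l\<close>. Finiteness of the spectrum lets
  \<open>Max\<close> bound \<open>l\<close>.\<close>

lemma inner_le_lambda_max:
  fixes Q :: "'a::euclidean_space \<Rightarrow> 'a"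
  assumes Q: "linear Q" and sym: "\<And>u v. Q u \<bullet> v = u \<bullet> Q v"
  shows "u \<bullet> Q u \<le> lambda_max Q * (u \<bullet> u)"
proof -
  interpret Q: linear Q by fact
  have "compact (sphere (0::'a) 1)" by simp
  moreover have "sphere (0::'a) 1 \<noteq> {}" by simp
  moreover have "continuous_on (sphere 0 1) (\<lambda>u. u \<bullet> Q u)"
    by (intro continuous_intros linear_continuous_on)
      (use Q in \<open>simp add: linear_conv_bounded_linear\<close>)
  ultimately have "\<exists>v\<in>sphere 0 1. \<forall>u\<in>sphere 0 1. u \<bullet> Q u \<le> v \<bullet> Q v"
    by (rule continuous_attains_sup)
  then obtain v where v: "v \<in> sphere 0 1" and max: "\<And>u. u \<in> sphere 0 1 \<Longrightarrow> u \<bullet> Q u \<le> v \<bullet> Q v"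
    by blast
  define l where "l = v \<bullet> Q v"
  have le: "u \<bullet> Q u \<le> l * (u \<bullet> u)" for u
  proof (cases "u = 0")
    case False
    then have "(1 / norm u) *\<^sub>R u \<in> sphere 0 1" by simp
    from max[OF this] have "((1 / norm u) *\<^sub>R u) \<bullet> Q ((1 / norm u) *\<^sub>R u) \<le> l"
      by (simp only: l_def)
    then have "(u \<bullet> Q u) / (norm u)\<^sup>2 \<le> l"
      by (simp add: Q.scaleR power2_eq_square)
    then show ?thesis using False by (simp add: pos_divide_le_eq dot_square_norm)
  qed (simp add: Q.zero)
  define R where "R u = l *\<^sub>R u - Q u" for u
  have "R v = 0"
  proof (rule psd_form_zero[of R])
    show "linear R"
      unfolding R_def by (rule linearI) (simp_all add: Q.add Q.scaleR algebra_simps)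
    show "\<And>u w. R u \<bullet> w = u \<bullet> R w"
      by (simp add: R_def inner_diff_left inner_diff_right sym)
    show "\<And>u. 0 \<le> u \<bullet> R u"
      using le by (simp add: R_def inner_diff_right)
    show "v \<bullet> R v = 0"
      using v by (simp add: R_def inner_diff_right l_def dot_square_norm)
  qed
  then have "Q v = l *\<^sub>R v" by (simp add: R_def)
  moreover have "v \<noteq> 0" using v by auto
  ultimately have "l \<in> eigenvalues Q" by (auto simp: eigenvalues_def)
  then have "l \<le> lambda_max Q"
    unfolding lambda_max_def using finite_eigenvalues[OF sym] by simp
  then have "l * (u \<bullet> u) \<le> lambda_max Q * (u \<bullet> u)" by (intro mult_right_mono) auto
  then show ?thesis using le[of u] by linarith
qed

section \<open>Subgradients and conjugates\<close>

text \<open>The relation that \<open>x\<close> belongs to the subdifferential of \<open>f\<close> at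
  \<open>s\<close>, with \<open>f s\<close> finite. Quantifying over real upper bounds
  \<open>r\<close> keeps the inequality inside the reals and makes it vacuous where \<open>f\<close>
  is infinite.\<close>

definition subgradient :: "('a::real_inner \<Rightarrow> ereal) \<Rightarrow> 'a \<Rightarrow> 'a \<Rightarrow> bool" where
  "subgradient f x s \<longleftrightarrow>
     (\<exists>t. f s = ereal t \<and> (\<forall>u r. f u \<le> ereal r \<longrightarrow> t + x \<bullet> (u - s) \<le> r))"

lemma subgradient_monotone:
  assumes "subgradient f x s" "subgradient f x' s'"
  shows "0 \<le> (x - x') \<bullet> (s - s')"
proof -
  obtain t where t: "f s = ereal t" "\<And>u r. f u \<le> ereal r \<Longrightarrow> t + x \<bullet> (u - s) \<le> r"
    using assms(1) by (auto simp: subgradient_def)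
  obtain t' where t': "f s' = ereal t'" "\<And>u r. f u \<le> ereal r \<Longrightarrow> t' + x' \<bullet> (u - s') \<le> r"
    using assms(2) by (auto simp: subgradient_def)
  show ?thesis using t(2)[of s' t'] t'(2)[of s t] t(1) t'(1)
    by (simp add: algebra_simps inner_diff_left inner_diff_right)
qed

lemma closed_proper_convexD:
  assumes "closed_proper_convex f"
  shows "f x \<noteq> -\<infinity>" and "\<exists>x t. f x = ereal t"
    and "convex (ereal_epigraph f)" and "closed (ereal_epigraph f)"
proof -
  show *: "f x \<noteq> -\<infinity>" for x
    using assms by (simp add: closed_proper_convex_def)
  obtain x where "f x < \<infinity>"
    using assms by (auto simp: closed_proper_convex_def effective_domain_def)
  then have "f x = ereal (real_of_ereal (f x))"
    using *[of x] by (cases "f x") auto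
  then show "\<exists>x t. f x = ereal t" by blast
qed (use assms in \<open>simp_all add: closed_proper_convex_def\<close>)

text \<open>Solved for \<open>f (S n)\<close>, the subgradient inequality says that a convergent
  sequence of points lies in the closed epigraph. Testing with one point where \<open>f\<close> is
  finite shows that \<open>f s\<close> is finite.\<close>

lemma subgradient_limit:
  assumes f: "closed_proper_convex f"
    and sub: "\<And>n. subgradient f (X n) (S n)" and lim: "X \<longlonglongrightarrow> x" "S \<longlonglongrightarrow> s"
  shows "subgradient f x s"
proof -
  have epi: "f s \<le> ereal (r - x \<bullet> (u - s))" if ur: "f u \<le> ereal r" for u r
  proof -
    have "(S n, r - X n \<bullet> (u - S n)) \<in> ereal_epigraph f" for n
    proof -
      obtain t where t: "f (S n) = ereal t" "t + X n \<bullet> (u - S n) \<le> r"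
        using sub[of n] ur unfolding subgradient_def by blast
      then show ?thesis by (simp add: ereal_epigraph_def)
    qed
    moreover have "(\<lambda>n. (S n, r - X n \<bullet> (u - S n))) \<longlonglongrightarrow> (s, r - x \<bullet> (u - s))"
      by (intro tendsto_intros lim)
    ultimately have "(s, r - x \<bullet> (u - s)) \<in> ereal_epigraph f"
      by (rule closed_sequentially[OF closed_proper_convexD(4)[OF f]])
    then show ?thesis by (simp add: ereal_epigraph_def)
  qed
  obtain u r where "f u = ereal r" using closed_proper_convexD(2)[OF f] by blast
  then obtain t where t: "f s = ereal t"
    using epi[of u r] closed_proper_convexD(1)[OF f, of s] by (cases "f s") auto
  have "t + x \<bullet> (u - s) \<le> r" if "f u \<le> ereal r" for u r
    using epi[OF that] by (simp add: t)
  then show ?thesis using t by (auto simp: subgradient_def)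
qed

lemma fenchel_conjugate_le_iff:
  assumes "closed_proper_convex f"
  shows "fenchel_conjugate f x \<le> ereal t \<longleftrightarrow> (\<forall>u r. f u \<le> ereal r \<longrightarrow> x \<bullet> u - r \<le> t)"
proof
  assume L: "fenchel_conjugate f x \<le> ereal t"
  show "\<forall>u r. f u \<le> ereal r \<longrightarrow> x \<bullet> u - r \<le> t"
  proof (intro allI impI)
    fix u r assume "f u \<le> ereal r"
    moreover have "ereal (x \<bullet> u) - f u \<le> ereal t"
      using L unfolding fenchel_conjugate_def by (meson SUP_le_iff UNIV_I)
    ultimately show "x \<bullet> u - r \<le> t"
      using closed_proper_convexD(1)[OF assms, of u] by (cases "f u") auto
  qed
next
  assume R: "\<forall>u r. f u \<le> ereal r \<longrightarrow> x \<bullet> u - r \<le> t"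
  show "fenchel_conjugate f x \<le> ereal t"
    unfolding fenchel_conjugate_def
  proof (rule SUP_least)
    fix u
    show "ereal (x \<bullet> u) - f u \<le> ereal t"
      using R[rule_format, of u "real_of_ereal (f u)"] closed_proper_convexD(1)[OF assms, of u]
      by (cases "f u") auto
  qed
qed

lemma fenchel_conjugate_not_MInf:
  assumes "closed_proper_convex f"
  shows "fenchel_conjugate f x \<noteq> -\<infinity>"
proof -
  obtain u r where u: "f u = ereal r" using closed_proper_convexD(2)[OF assms] by blast
  have "ereal (x \<bullet> u - r) \<le> fenchel_conjugate f x"
    unfolding fenchel_conjugate_def by (rule SUP_upper2[of u]) (auto simp: u)
  then show ?thesis by auto
qed

lemma fenchel_young_equality:
  assumes f: "closed_proper_convex f" and sub: "subgradient f x s"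
  shows "\<exists>t. f s = ereal t \<and> fenchel_conjugate f x = ereal (x \<bullet> s - t)"
proof -
  obtain t where t: "f s = ereal t" "\<And>u r. f u \<le> ereal r \<Longrightarrow> t + x \<bullet> (u - s) \<le> r"
    using sub by (auto simp: subgradient_def)
  have "fenchel_conjugate f x \<le> ereal (x \<bullet> s - t)"
    unfolding fenchel_conjugate_le_iff[OF f] using t(2) by (force simp: inner_diff_right)
  moreover have "ereal (x \<bullet> s - t) \<le> fenchel_conjugate f x"
    unfolding fenchel_conjugate_def by (rule SUP_upper2[of s]) (auto simp: t)
  ultimately show ?thesis using t(1) by (auto intro: antisym)
qed

text \<open>The inversion from \<open>s\<close> in the subdifferential of the conjugate at
  \<open>x\<close> to \<open>x\<close> in that of \<open>f\<close> at \<open>s\<close>. It suffices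
  that \<open>f s \<le> x \<bullet> s - t\<close>; otherwise a hyperplane strictly separating this
  point from the epigraph bounds the conjugate at some point too low for \<open>sub\<close>.\<close>

lemma subgradient_of_conjugate:
  assumes f: "closed_proper_convex f"
    and fx: "fenchel_conjugate f x = ereal t"
    and sub: "\<And>x' r. fenchel_conjugate f x' \<le> ereal r \<Longrightarrow> t + s \<bullet> (x' - x) \<le> r"
  shows "subgradient f x s"
proof -
  note conj_le = fenchel_conjugate_le_iff[OF f]
  have fx_le: "x \<bullet> u - r \<le> t" if "f u \<le> ereal r" for u r
    using conj_le[of x t] fx that by auto
  have mem: "(s, x \<bullet> s - t) \<in> ereal_epigraph f"
  proof (rule ccontr)
    assume "(s, x \<bullet> s - t) \<notin> ereal_epigraph f"
    from separating_hyperplane_closed_point[OF closed_proper_convexD(3)[OF f]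
        closed_proper_convexD(4)[OF f] this]
    obtain a \<beta> \<gamma> where sep: "a \<bullet> s + \<beta> * (x \<bullet> s - t) < \<gamma>"
      and epi: "\<And>u r. f u \<le> ereal r \<Longrightarrow> \<gamma> < a \<bullet> u + \<beta> * r"
      by (auto simp: ereal_epigraph_def)
    obtain u0 r0 where u0: "f u0 = ereal r0" using closed_proper_convexD(2)[OF f] by blast
    have "0 \<le> \<beta>"
    proof (rule ccontr)
      assume "\<not> 0 \<le> \<beta>"
      \<comment> \<open>Epigraphs are unbounded upwards, so a negative \<beta> would let
        \<open>\<beta> * r\<close> drop below the separation level.\<close>
      define r where "r = max r0 ((\<gamma> - a \<bullet> u0) / \<beta>)"
      have "\<gamma> < a \<bullet> u0 + \<beta> * r" by (rule epi) (simp add: u0 r_def)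
      moreover have "\<beta> * r \<le> \<beta> * ((\<gamma> - a \<bullet> u0) / \<beta>)"
        using \<open>\<not> 0 \<le> \<beta>\<close> by (intro mult_left_mono_neg) (auto simp: r_def)
      ultimately show False using \<open>\<not> 0 \<le> \<beta>\<close> by simp
    qed
    then consider "\<beta> = 0" | "\<beta> > 0" by linarith
    then show False
    proof cases
      \<comment> \<open>Vertical hyperplane: the domain of \<open>f\<close> lies in the half-space
        \<open>\<gamma> < a \<bullet> u\<close>, so moving from \<open>x\<close> to
        \<open>x - a\<close> lowers the conjugate by at least \<gamma>.\<close>
      case 1
      have "fenchel_conjugate f (x - a) \<le> ereal (t - \<gamma>)"
        unfolding conj_le
      proof (intro allI impI)
        fix u r assume ur: "f u \<le> ereal r"
        show "(x - a) \<bullet> u - r \<le> t - \<gamma>"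
          using fx_le[OF ur] epi[OF ur] 1 by (simp add: inner_diff_left)
      qed
      from sub[OF this] sep 1 show False by (simp add: inner_commute)
    next
      \<comment> \<open>Dividing by \<beta> turns the hyperplane into an affine minorant of
        \<open>f\<close> with slope \<open>- (1 / \<beta>) *\<^sub>R a\<close>, at which the
        conjugate is bounded.\<close>
      case 2
      have "fenchel_conjugate f (- (1 / \<beta>) *\<^sub>R a) \<le> ereal (- \<gamma> / \<beta>)"
        unfolding conj_le
      proof (intro allI impI)
        fix u r assume ur: "f u \<le> ereal r"
        have "(- (1 / \<beta>) *\<^sub>R a) \<bullet> u - r = - (a \<bullet> u + \<beta> * r) / \<beta>"
          using 2 by (simp add: field_simps)
        also have "\<dots> \<le> - \<gamma> / \<beta>"
          using epi[OF ur] 2 by (intro divide_right_mono) auto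
        finally show "(- (1 / \<beta>) *\<^sub>R a) \<bullet> u - r \<le> - \<gamma> / \<beta>" .
      qed
      from sub[OF this] have "t - (a \<bullet> s) / \<beta> - x \<bullet> s \<le> - \<gamma> / \<beta>"
        by (simp add: inner_diff_right inner_commute)
      then have "\<beta> * \<gamma> \<le> \<beta> * (a \<bullet> s + \<beta> * (x \<bullet> s - t))"
        using 2 by (simp add: field_simps)
      then have "\<gamma> \<le> a \<bullet> s + \<beta> * (x \<bullet> s - t)"
        using 2 by simp
      then show False using sep by simp
    qed
  qed
  then have "f s \<le> ereal (x \<bullet> s - t)" by (simp add: ereal_epigraph_def)
  moreover then obtain t' where t': "f s = ereal t'"
    using closed_proper_convexD(1)[OF f, of s] by (cases "f s") auto
  ultimately have "t' \<le> x \<bullet> s - t" by simp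
  then have "t' + x \<bullet> (u - s) \<le> r" if "f u \<le> ereal r" for u r
    using fx_le[OF that] by (simp add: inner_diff_right)
  then show ?thesis using t' by (auto simp: subgradient_def)
qed

section \<open>First-order comparison along segments, and Lagrange multipliers\<close>

lemma nonpos_if_le_square:
  fixes a K :: real
  assumes "\<And>t. 0 < t \<Longrightarrow> t < 1 \<Longrightarrow> t * a \<le> t\<^sup>2 * K"
  shows "a \<le> 0"
proof (rule tendsto_lowerbound)
  show "((\<lambda>t. t * K) \<longlongrightarrow> 0) (at_right 0)"
    by (intro tendsto_eq_intros) auto
  have "eventually (\<lambda>t. t \<in> {0<..<1::real}) (at_right 0)"
    by (rule eventually_at_right_real) simp
  then show "eventually (\<lambda>t. a \<le> t * K) (at_right 0)"
  proof eventually_elim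
    case (elim t)
    then have "t * a \<le> t * (t * K)"
      using assms[of t] by (simp add: power2_eq_square mult.assoc)
    then show ?case using elim by simp
  qed
qed simp

lemma convex_ereal_epigraphD:
  assumes "convex (ereal_epigraph f)" "f x \<le> ereal r" "f y \<le> ereal s" "0 \<le> t" "t \<le> 1"
  shows "f (x + t *\<^sub>R (y - x)) \<le> ereal (r + t * (s - r))"
proof -
  have "(1 - t) *\<^sub>R (x, r) + t *\<^sub>R (y, s) \<in> ereal_epigraph f"
    using assms by (intro convexD) (auto simp: ereal_epigraph_def)
  then show ?thesis by (simp add: ereal_epigraph_def algebra_simps)
qed

lemma convex_ereal_epigraph_fenchel_conjugate:
  assumes "closed_proper_convex f"
  shows "convex (ereal_epigraph (fenchel_conjugate f))"
proof -
  have "ereal_epigraph (fenchel_conjugate f) =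
      (\<Inter>(u, r)\<in>ereal_epigraph f. {p. (u, -1) \<bullet> p \<le> r})"
    by (auto simp: ereal_epigraph_def fenchel_conjugate_le_iff[OF assms] inner_commute
        algebra_simps)
  then show ?thesis
    by (simp only:) (intro convex_INT, auto intro: convex_halfspace_le)
qed

text \<open>The relative interior point makes the supporting hyperplane at the optimal value
  non-vertical.\<close>

lemma affine_constraint_multiplier:
  fixes A :: "'a::euclidean_space \<Rightarrow> 'b::real_inner" and E :: "('a \<times> real) set"
  assumes "linear A" and "convex E"
    and up: "\<And>x t t'. (x, t) \<in> E \<Longrightarrow> t \<le> t' \<Longrightarrow> (x, t') \<in> E"
    and ri: "\<xi> \<in> rel_interior (fst ` E)" "A \<xi> = b"
    and opt: "(x, T) \<in> E" "A x = b" "\<And>x' t. (x', t) \<in> E \<Longrightarrow> A x' = b \<Longrightarrow> T \<le> t"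
  shows "\<exists>y. \<forall>(x', t)\<in>E. T + y \<bullet> (A x' - b) \<le> t"
proof -
  interpret A: linear A by fact
  define N where "N = {m. A m = b} \<times> {T}"
  \<comment> \<open>Separating \<open>E\<close> from the constraint slice \<open>N\<close> at height
    \<open>T\<close> amounts to supporting their difference set at the origin.\<close>
  define S where "S = (\<Union>p\<in>E. \<Union>q\<in>N. {p - q})"
  have SI: "(x' - m, t - T) \<in> S" if "(x', t) \<in> E" "A m = b" for x' t m
    using that by (force simp: S_def N_def)
  have "convex {m. A m = b}"
    by (rule convexI) (simp add: A.add A.scaleR flip: scaleR_left_distrib)
  then have "convex N" unfolding N_def by (intro convex_Times) auto
  then have conv: "convex S" unfolding S_def by (rule convex_differences[OF \<open>convex E\<close>])
  have zero: "(0, 0) \<in> S" using SI[OF opt(1,2)] by simp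
  have one: "(0, 1) \<in> S" using SI[OF up[OF opt(1), of "T + 1"] opt(2)] by simp
  have "(0, 0) \<notin> rel_interior S"
  proof
    assume "(0, 0) \<in> rel_interior S"
    \<comment> \<open>From a relative interior point the segment starting at \<open>(0, 1)\<close>
      could be prolonged beyond the origin, giving a feasible point with value below
      \<open>T\<close>.\<close>
    with one zero obtain e :: real where e: "e > 1" and "(1 - e) *\<^sub>R (0, 1) + e *\<^sub>R (0, 0) \<in> S"
      using convex_rel_interior_iff[OF conv, of "(0, 0)"] by blast
    then have "(0, 1 - e) \<in> S" by simp
    then obtain m t where "(m, t) \<in> E" "A m = b" "1 - e = t - T"
      by (auto simp: S_def N_def)
    then show False using opt(3)[of m t] e by auto
  qed
  then obtain w where "w \<noteq> 0" and pos: "\<And>q. q \<in> S \<Longrightarrow> w \<bullet> (0, 0) \<le> w \<bullet> q"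
    and strict: "\<And>q. q \<in> rel_interior S \<Longrightarrow> w \<bullet> (0, 0) < w \<bullet> q"
    by (rule supporting_hyperplane_rel_boundary[OF conv zero]) (rule that; blast)
  obtain p \<alpha> where w: "w = (p, \<alpha>)" by (cases w)
  have pos': "0 \<le> p \<bullet> (x' - m) + \<alpha> * (t - T)" if "(x', t) \<in> E" "A m = b" for x' m t
    using pos[OF SI[OF that]] by (simp add: w zero_prod_def[symmetric])
  have "0 \<le> \<alpha>" using pos[OF one] by (simp add: w zero_prod_def[symmetric])
  \<comment> \<open>Feasible points may be moved by \<open>h\<close> and by \<open>- h\<close>, so
    both signs of \<open>p \<bullet> h\<close> are excluded.\<close>
  have orth: "p \<bullet> h = 0" if "A h = 0" for h
    using pos'[OF opt(1), of "x + h"] pos'[OF opt(1), of "x - h"] that opt(2)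
    by (simp add: A.add A.diff)
  have "\<alpha> \<noteq> 0"
  proof
    \<comment> \<open>A vertical hyperplane gives a linear function that is nonnegative on the
      projected set and zero at the relative interior point \<xi>. Prolonging segments through \<xi>
      makes it vanish throughout, against strictness on \<open>rel_interior S\<close>.\<close>
    assume "\<alpha> = 0"
    have "convex (fst ` E)" by (intro convex_linear_image linear_fst \<open>convex E\<close>)
    moreover have "fst ` E \<noteq> {}" using opt(1) by auto
    ultimately have ext: "\<exists>e>1. (1 - e) *\<^sub>R x' + e *\<^sub>R \<xi> \<in> fst ` E" if "x' \<in> fst ` E" for x'
      using convex_rel_interior_iff ri(1) that by blast
    have D: "0 \<le> p \<bullet> (x' - \<xi>)" if "x' \<in> fst ` E" for x'
      using pos' that ri(2) \<open>\<alpha> = 0\<close> by fastforce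
    have D0: "p \<bullet> (x' - \<xi>) = 0" if x': "x' \<in> fst ` E" for x'
    proof -
      obtain e where e: "e > 1" "(1 - e) *\<^sub>R x' + e *\<^sub>R \<xi> \<in> fst ` E" using ext[OF x'] by blast
      have "(1 - e) *\<^sub>R x' + e *\<^sub>R \<xi> - \<xi> = (1 - e) *\<^sub>R (x' - \<xi>)" by (simp add: algebra_simps)
      then have "0 \<le> (1 - e) * (p \<bullet> (x' - \<xi>))" using D[OF e(2)] by simp
      then show ?thesis using D[OF x'] e(1) by (simp add: zero_le_mult_iff)
    qed
    have "rel_interior S \<noteq> {}" using rel_interior_eq_empty[OF conv] zero by blast
    then obtain q where q: "q \<in> rel_interior S" by blast
    then have "q \<in> S" using rel_interior_subset by blast
    then obtain x' t m where E: "(x', t) \<in> E" and m: "A m = b" and q_eq: "q = (x' - m, t - T)"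
      by (auto simp: S_def N_def)
    have "p \<bullet> (x' - \<xi>) = 0" using D0 E by force
    moreover have "p \<bullet> (\<xi> - m) = 0" using orth[of "\<xi> - m"] m ri(2) by (simp add: A.diff)
    ultimately have "p \<bullet> (x' - m) = 0" by (simp add: inner_diff_right)
    then show False using strict[OF q] \<open>\<alpha> = 0\<close>
      by (simp add: w q_eq zero_prod_def[symmetric])
  qed
  with \<open>0 \<le> \<alpha>\<close> have "\<alpha> > 0" by simp
  obtain y where y: "p = adjoint A y"
    using orthogonal_kernel_imp_range_adjoint[OF \<open>linear A\<close> orth] by blast
  \<comment> \<open>Normalizing the supporting hyperplane to have vertical coefficient 1 gives the
    multiplier.\<close>
  have "T + (- (1 / \<alpha>) *\<^sub>R y) \<bullet> (A x' - b) \<le> t" if "(x', t) \<in> E" for x' t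
  proof -
    have "p \<bullet> (x' - x) = y \<bullet> (A x' - b)"
      using adjoint_inner[OF \<open>linear A\<close>, of "x' - x" y] opt(2) by (simp add: y A.diff inner_commute)
    then have "0 \<le> (y \<bullet> (A x' - b) + \<alpha> * (t - T)) / \<alpha>"
      using pos'[OF that opt(2)] \<open>\<alpha> > 0\<close> by simp
    also have "\<dots> = (y \<bullet> (A x' - b)) / \<alpha> + (t - T)"
      using \<open>\<alpha> > 0\<close> by (simp add: add_divide_distrib)
    finally show ?thesis by simp
  qed
  then show ?thesis by blast
qed

section \<open>Proximal subproblems\<close>

lemma norm_add_square_expand:
  fixes u v :: "'a::real_inner"
  shows "(norm (u + v))\<^sup>2 = (norm u)\<^sup>2 + 2 * (u \<bullet> v) + (norm v)\<^sup>2"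
  by (simp add: dot_square_norm[symmetric] inner_add_left inner_add_right inner_commute)

text \<open>If the subgradient inequality holds, the exact expansion of the square leaves a
  nonnegative remainder. Conversely, comparison with points near \<open>z\<close> leaves an error
  quadratic in the step. The subgradient \<open>x + \<sigma> *\<^sub>R (a + z)\<close> has the form
  of the multiplier update in Step 4.\<close>

lemma prox_argmin_iff:
  fixes f :: "'a::euclidean_space \<Rightarrow> ereal"
  assumes f: "closed_proper_convex f" and "0 < \<sigma>"
  shows "is_arg_min (\<lambda>z. f (- z) + ereal (z \<bullet> x) + ereal (\<sigma>/2 * (norm (a + z))\<^sup>2)) (\<lambda>_. True) z
    \<longleftrightarrow> subgradient f (x + \<sigma> *\<^sub>R (a + z)) (- z)" (is "is_arg_min ?G _ z \<longleftrightarrow> _")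
proof
  assume sub: "subgradient f (x + \<sigma> *\<^sub>R (a + z)) (- z)"
  then obtain t where t: "f (- z) = ereal t"
    "\<And>u r. f u \<le> ereal r \<Longrightarrow> t + (x + \<sigma> *\<^sub>R (a + z)) \<bullet> (u + z) \<le> r"
    by (auto simp: subgradient_def)
  have "?G z \<le> ?G z'" for z'
  proof (cases "f (- z')")
    case (real r)
    have "t + (x + \<sigma> *\<^sub>R (a + z)) \<bullet> (- z' + z) \<le> r" using t(2)[of "- z'" r] real by simp
    moreover have "(norm (a + z'))\<^sup>2 = (norm (a + z))\<^sup>2 + 2 * ((a + z) \<bullet> (z' - z)) + (norm (z' - z))\<^sup>2"
      using norm_add_square_expand[of "a + z" "z' - z"] by simp
    then have "\<sigma>/2 * (norm (a + z'))\<^sup>2 =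
        \<sigma>/2 * (norm (a + z))\<^sup>2 + \<sigma> * ((a + z) \<bullet> (z' - z)) + \<sigma>/2 * (norm (z' - z))\<^sup>2"
      by (simp only:) (simp add: distrib_left)
    moreover have "0 \<le> \<sigma>/2 * (norm (z' - z))\<^sup>2" using \<open>0 < \<sigma>\<close> by simp
    moreover have "(x + \<sigma> *\<^sub>R (a + z)) \<bullet> (- z' + z) = z \<bullet> x - z' \<bullet> x - \<sigma> * ((a + z) \<bullet> (z' - z))"
      by (simp add: inner_add_left inner_add_right inner_diff_right inner_commute algebra_simps)
    ultimately have "t + z \<bullet> x + \<sigma>/2 * (norm (a + z))\<^sup>2 \<le> r + z' \<bullet> x + \<sigma>/2 * (norm (a + z'))\<^sup>2"
      by linarith
    then show ?thesis by (simp add: t(1) real)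
  next
    case MInf
    then show ?thesis using closed_proper_convexD(1)[OF f] by blast
  qed simp
  then show "is_arg_min ?G (\<lambda>_. True) z" by (simp add: is_arg_min_linorder)
next
  assume "is_arg_min ?G (\<lambda>_. True) z"
  then have min: "?G z \<le> ?G z'" for z' by (simp add: is_arg_min_linorder)
  obtain u0 r0 where "f u0 = ereal r0" using closed_proper_convexD(2)[OF f] by blast
  then obtain t where t: "f (- z) = ereal t"
    using min[of "- u0"] closed_proper_convexD(1)[OF f, of "- z"] by (cases "f (- z)") auto
  have "t + (x + \<sigma> *\<^sub>R (a + z)) \<bullet> (u - - z) \<le> r" if ur: "f u \<le> ereal r" for u r
  proof -
    have "t + (x + \<sigma> *\<^sub>R (a + z)) \<bullet> (u + z) - r \<le> 0"
    proof (rule nonpos_if_le_square)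
      fix \<tau> :: real assume l: "0 < \<tau>" "\<tau> < 1"
      \<comment> \<open>Chosen so that \<open>- z'\<close> is the point of the segment from
        \<open>- z\<close> to \<open>u\<close> at parameter \<tau>.\<close>
      define z' where "z' = z - \<tau> *\<^sub>R (u + z)"
      have "f (- z') \<le> ereal (t + \<tau> * (r - t))"
        using convex_ereal_epigraphD[OF closed_proper_convexD(3)[OF f], of "- z" t u r \<tau>] ur l
        by (simp add: z'_def t algebra_simps)
      then have "?G z' \<le> ereal (t + \<tau> * (r - t)) + ereal (z' \<bullet> x) + ereal (\<sigma>/2 * (norm (a + z'))\<^sup>2)"
        by (intro add_right_mono)
      from order_trans[OF min[of z'] this]
      have "t + z \<bullet> x + \<sigma>/2 * (norm (a + z))\<^sup>2 \<le>
          t + \<tau> * (r - t) + z' \<bullet> x + \<sigma>/2 * (norm (a + z'))\<^sup>2"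
        by (simp add: t)
      moreover have "(norm (a + z'))\<^sup>2 = (norm (a + z))\<^sup>2 - 2 * \<tau> * ((a + z) \<bullet> (u + z))
          + \<tau>\<^sup>2 * (norm (u + z))\<^sup>2"
        using norm_add_square_expand[of "a + z" "- (\<tau> *\<^sub>R (u + z))"]
        by (simp add: z'_def add_diff_eq power_mult_distrib del: scaleR_right.add)
      then have "\<sigma>/2 * (norm (a + z'))\<^sup>2 = \<sigma>/2 * (norm (a + z))\<^sup>2 - \<tau> * (\<sigma> * ((a + z) \<bullet> (u + z)))
          + \<tau>\<^sup>2 * (\<sigma>/2 * (norm (u + z))\<^sup>2)"
        by (simp only:) (simp add: distrib_left right_diff_distrib)
      moreover have "z' \<bullet> x = z \<bullet> x - \<tau> * (x \<bullet> (u + z))"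
        by (simp add: z'_def inner_commute[of _ x] inner_diff_right)
      moreover have "\<tau> * (t + (x + \<sigma> *\<^sub>R (a + z)) \<bullet> (u + z) - r) =
          \<tau> * (x \<bullet> (u + z)) + \<tau> * (\<sigma> * ((a + z) \<bullet> (u + z))) - \<tau> * (r - t)"
        by (simp only: inner_add_left[of x] inner_scaleR_left) (simp add: algebra_simps)
      ultimately show "\<tau> * (t + (x + \<sigma> *\<^sub>R (a + z)) \<bullet> (u + z) - r)
          \<le> \<tau>\<^sup>2 * (\<sigma>/2 * (norm (u + z))\<^sup>2)"
        by linarith
    qed
    then show ?thesis by simp
  qed
  then show "subgradient f (x + \<sigma> *\<^sub>R (a + z)) (- z)"
    using t by (auto simp: subgradient_def)
qed

text \<open>The minimization is moved to the epigraph, where \<open>\<Phi>\<close> is continuous and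
  the set is closed; this replaces lower semicontinuity of \<open>f\<close>. The affine minorant
  makes the relevant sublevel set bounded. The first coordinate of an epigraph point stands for
  \<open>- z\<close>.\<close>

lemma prox_argmin_exists:
  fixes f :: "'a::euclidean_space \<Rightarrow> ereal"
  assumes f: "closed_proper_convex f" and "0 < \<sigma>"
    and minorant: "\<And>u r. f u \<le> ereal r \<Longrightarrow> p \<bullet> u - m \<le> r"
  shows "\<exists>z. is_arg_min (\<lambda>z. f (- z) + ereal (z \<bullet> x) + ereal (\<sigma>/2 * (norm (a + z))\<^sup>2)) (\<lambda>_. True) z"
    (is "\<exists>z. is_arg_min ?G _ z")
proof -
  define \<Phi> where "\<Phi> q = snd q - fst q \<bullet> x + \<sigma>/2 * (norm (a - fst q))\<^sup>2" for q :: "'a \<times> real"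
  obtain u0 r0 where u0: "f u0 = ereal r0" using closed_proper_convexD(2)[OF f] by blast
  define M where "M = \<Phi> (u0, r0)"
  define K where "K = ereal_epigraph f \<inter> {q. \<Phi> q \<le> M}"
  have cont: "continuous_on S \<Phi>" for S
    unfolding \<Phi>_def by (intro continuous_intros)
  define C where "C = \<bar>M + m - (p - x) \<bullet> a\<bar>"
  \<comment> \<open>For a distance \<open>D > 1\<close> from \<open>a\<close>, the minorant and the
    sublevel bound give \<open>\<sigma>/2 * D\<^sup>2 \<le> (norm (p - x) + C) * D\<close>; dividing
    by \<open>D\<close> yields this radius.\<close>
  define B where "B = max 1 (2 * (norm (p - x) + C) / \<sigma>)"
  define R where "R = norm a + B"
  have "K \<subseteq> cball a B \<times> {- (norm p * R) - m .. M + R * norm x}"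
  proof
    fix q assume q: "q \<in> K"
    obtain s t where st: "q = (s, t)" by (cases q)
    have low: "p \<bullet> s - m \<le> t" using q minorant by (auto simp: K_def st ereal_epigraph_def)
    have up: "t - s \<bullet> x + \<sigma>/2 * (norm (a - s))\<^sup>2 \<le> M" using q by (simp add: K_def st \<Phi>_def)
    define D where "D = norm (a - s)"
    have "D \<le> B"
    proof (cases "D \<le> 1")
      case False
      have "(p - x) \<bullet> (a - s) \<le> norm (p - x) * D"
        unfolding D_def by (rule norm_cauchy_schwarz)
      moreover have "(p - x) \<bullet> (a - s) = (p - x) \<bullet> a - p \<bullet> s + s \<bullet> x"
        by (simp add: inner_diff_left inner_diff_right inner_commute)
      moreover have "M + m - (p - x) \<bullet> a \<le> C" by (simp add: C_def)
      ultimately have "\<sigma>/2 * D\<^sup>2 \<le> norm (p - x) * D + C"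
        using low up unfolding D_def by linarith
      also have "\<dots> \<le> norm (p - x) * D + C * D"
        using False by (simp add: C_def mult_le_cancel_left1)
      finally have "(\<sigma>/2 * D) * D \<le> (norm (p - x) + C) * D"
        by (simp add: power2_eq_square algebra_simps)
      then have "\<sigma>/2 * D \<le> norm (p - x) + C" using False by simp
      then show ?thesis using \<open>0 < \<sigma>\<close> by (simp add: B_def field_simps le_max_iff_disj)
    qed (simp add: B_def)
    then have sR: "norm s \<le> R"
      using norm_triangle_ineq4[of a "a - s"] by (simp add: D_def R_def)
    have "s \<bullet> x \<le> R * norm x"
      using norm_cauchy_schwarz[of s x] mult_right_mono[OF sR, of "norm x"] by simp
    moreover have "0 \<le> \<sigma>/2 * (norm (a - s))\<^sup>2" using \<open>0 < \<sigma>\<close> by simp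
    ultimately have "t \<le> M + R * norm x" using up by linarith
    moreover have "- (norm p * R) \<le> p \<bullet> s"
      using Cauchy_Schwarz_ineq2[of p s] mult_left_mono[OF sR, of "norm p"] by (simp add: abs_le_iff)
    ultimately show "q \<in> cball a B \<times> {- (norm p * R) - m .. M + R * norm x}"
      using \<open>D \<le> B\<close> low by (simp add: st D_def dist_norm)
  qed
  then have "bounded K"
    by (rule bounded_subset[rotated]) (intro bounded_Times bounded_cball bounded_closed_interval)
  moreover have "closed K"
    unfolding K_def
    by (intro closed_Int closed_proper_convexD(4)[OF f] closed_Collect_le cont continuous_on_const)
  ultimately have "compact K" by (simp add: compact_eq_bounded_closed)
  moreover have u0K: "(u0, r0) \<in> K" by (simp add: K_def M_def ereal_epigraph_def u0)
  then have "K \<noteq> {}" by blast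
  ultimately obtain q where q: "q \<in> K" and min: "\<And>q'. q' \<in> K \<Longrightarrow> \<Phi> q \<le> \<Phi> q'"
    using continuous_attains_inf[OF _ _ cont] by metis
  have min': "\<Phi> q \<le> \<Phi> q'" if "q' \<in> ereal_epigraph f" for q'
    using min[of q'] min[OF u0K] that by (force simp: K_def M_def)
  obtain s t where st: "q = (s, t)" by (cases q)
  have "?G (- s) \<le> ereal (\<Phi> q)"
  proof -
    have "f s \<le> ereal t" using q by (simp add: K_def st ereal_epigraph_def)
    then have "f s + ereal (- s \<bullet> x) + ereal (\<sigma>/2 * (norm (a - s))\<^sup>2)
        \<le> ereal t + ereal (- s \<bullet> x) + ereal (\<sigma>/2 * (norm (a - s))\<^sup>2)"
      by (intro add_right_mono)
    then show ?thesis by (simp add: \<Phi>_def st)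
  qed
  moreover have "ereal (\<Phi> q) \<le> ?G z" for z
  proof (cases "f (- z)")
    case (real r)
    then have "(- z, r) \<in> ereal_epigraph f" by (simp add: ereal_epigraph_def)
    from min'[OF this] show ?thesis by (simp add: real \<Phi>_def)
  next
    case MInf
    then show ?thesis using closed_proper_convexD(1)[OF f] by blast
  qed simp
  ultimately have "is_arg_min ?G (\<lambda>_. True) (- s)"
    unfolding is_arg_min_linorder by (blast intro: order_trans)
  then show ?thesis by blast
qed

section \<open>Optimality conditions\<close>

locale composite_problem =
  fixes \<theta> :: "'a::euclidean_space \<Rightarrow> ereal"
    and Q :: "'a \<Rightarrow> 'a" and A :: "'a \<Rightarrow> 'b::real_inner" and b :: 'b and c :: 'a
  assumes theta: "closed_proper_convex \<theta>"
    and linear_Q: "linear Q" and sym_Q: "Q u \<bullet> v = u \<bullet> Q v" and psd_Q: "0 \<le> u \<bullet> Q u"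
    and linear_A: "linear A" and surj_A: "surj A"
begin

sublocale Q: linear Q by (rule linear_Q)
sublocale A: linear A by (rule linear_A)
sublocale A': linear "adjoint A" by (rule linear_adjoint[OF linear_A])

text \<open>The joint optimality system of (P) and (D), with the dual variable \<open>w\<close>
  identified with \<open>x\<close>.\<close>

definition kkt :: "'a \<Rightarrow> 'b \<Rightarrow> 'a \<Rightarrow> bool" where
  "kkt x y z \<longleftrightarrow> A x = b \<and> adjoint A y + z - Q x - c = 0 \<and> subgradient \<theta> x (- z)"

lemma quadratic_expand:
  "1/2 * (u \<bullet> Q u) = 1/2 * (x \<bullet> Q x) + Q x \<bullet> (u - x) + 1/2 * ((u - x) \<bullet> Q (u - x))"
  using sym_Q[of x u]
  by (simp add: Q.diff inner_diff_left inner_diff_right inner_commute algebra_simps)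

lemma quadratic_ge: "1/2 * (x \<bullet> Q x) + Q x \<bullet> (u - x) \<le> 1/2 * (u \<bullet> Q u)"
  using quadratic_expand[of u x] psd_Q[of "u - x"] by linarith

text \<open>Fenchel's equality at \<open>x\<close>, its inequality at \<open>u\<close> with slope
  \<open>- z\<close>, and linearization of the quadratic combine; the term with
  \<open>adjoint A y\<close> drops out because \<open>u - x\<close> is in the kernel of
  \<open>A\<close>.\<close>

lemma kkt_imp_primal_solution:
  assumes "kkt x y z"
  shows "x \<in> primal_solutions \<theta> Q A b c"
proof -
  have Ax: "A x = b" and eq: "Q x + c = adjoint A y + z" and sub: "subgradient \<theta> x (- z)"
    using assms by (auto simp: kkt_def algebra_simps)
  obtain t where t: "\<theta> (- z) = ereal t" and conj: "fenchel_conjugate \<theta> x = ereal (x \<bullet> - z - t)"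
    using fenchel_young_equality[OF theta sub] by blast
  have "primal_objective \<theta> Q c x \<le> primal_objective \<theta> Q c u" if "A u = b" for u
  proof (cases "fenchel_conjugate \<theta> u")
    case (real r)
    have "u \<bullet> - z - t \<le> r"
      using fenchel_conjugate_le_iff[OF theta, THEN iffD1, rule_format, of u r "- z" t] real t
      by simp
    moreover have "(Q x + c) \<bullet> (u - x) = z \<bullet> (u - x)"
      using adjoint_inner[OF linear_A, of "u - x" y] that Ax
      by (simp add: eq inner_add_left inner_add_right A.diff inner_commute[of _ "u - x"])
    moreover note quadratic_ge[of x u]
    ultimately have "x \<bullet> - z - t + 1/2 * (x \<bullet> Q x) + c \<bullet> x \<le> r + 1/2 * (u \<bullet> Q u) + c \<bullet> u"
      by (simp add: inner_add_left inner_diff_right inner_commute[of z])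
    then show ?thesis by (simp add: primal_objective_def conj real)
  next
    case MInf
    then show ?thesis using fenchel_conjugate_not_MInf[OF theta] by blast
  qed (simp add: primal_objective_def)
  moreover have "primal_objective \<theta> Q c x < \<infinity>" by (simp add: primal_objective_def conj)
  ultimately show ?thesis
    using Ax by (simp add: primal_solutions_def solution_set_def is_arg_min_linorder)
qed

text \<open>Pairing the difference of the two dual constraints with \<open>x\<close> rewrites the
  slope of the quadratic along \<open>w' - x\<close> as
  \<open>b \<bullet> (y' - y) + x \<bullet> (z' - z)\<close>, which balances the linear term and the
  subgradient inequality.\<close>

lemma kkt_imp_dual_solution:
  assumes "kkt x y z"
  shows "(x, y, z) \<in> dual_solutions \<theta> Q A b c"
proof -
  have Ax: "A x = b" and eq: "- Q x + adjoint A y + z = c" and sub: "subgradient \<theta> x (- z)"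
    using assms by (auto simp: kkt_def algebra_simps)
  obtain t where t: "\<theta> (- z) = ereal t" "\<And>u r. \<theta> u \<le> ereal r \<Longrightarrow> t + x \<bullet> (u + z) \<le> r"
    using sub by (auto simp: subgradient_def)
  have "dual_objective \<theta> Q b (x, y, z) \<le> dual_objective \<theta> Q b (w', y', z')"
    if feas: "- Q w' + adjoint A y' + z' = c" for w' y' z'
  proof (cases "\<theta> (- z')")
    case (real r)
    have 1: "t + x \<bullet> (- z' + z) \<le> r" using t(2)[of "- z'" r] real by simp
    have "Q (w' - x) = adjoint A (y' - y) + (z' - z)"
      using feas eq by (simp add: Q.diff A'.diff algebra_simps)
    then have "x \<bullet> Q (w' - x) = b \<bullet> (y' - y) + x \<bullet> (z' - z)"
      using adjoint_inner[OF linear_A, of x "y' - y"] Ax by (simp add: inner_add_right)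
    then have "Q x \<bullet> (w' - x) = b \<bullet> y' - b \<bullet> y + x \<bullet> z' - x \<bullet> z"
      by (simp only: sym_Q) (simp add: inner_diff_right)
    with 1 quadratic_ge[of x w']
    have "1/2 * (x \<bullet> Q x) - b \<bullet> y + t \<le> 1/2 * (w' \<bullet> Q w') - b \<bullet> y' + r"
      by (simp add: inner_add_right inner_diff_right)
    then show ?thesis by (simp add: dual_objective_def t(1) real)
  next
    case MInf
    then show ?thesis using closed_proper_convexD(1)[OF theta] by blast
  qed (simp add: dual_objective_def)
  moreover have "dual_objective \<theta> Q b (x, y, z) < \<infinity>" by (simp add: dual_objective_def t(1))
  ultimately show ?thesis
    using eq by (auto simp: dual_solutions_def solution_set_def is_arg_min_linorder)
qed

text \<open>A solution of (P) also solves the problem with the quadratic linearized at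
  \<open>x\<close>. The multiplier \<open>y\<close> of that convex problem makes
  \<open>adjoint A y - d\<close> a subgradient of the conjugate at \<open>x\<close>, and inversion
  gives the condition on \<theta>.\<close>

lemma kkt_exists:
  assumes ri: "\<xi> \<in> rel_interior (effective_domain (fenchel_conjugate \<theta>))" "A \<xi> = b"
    and sol: "x \<in> primal_solutions \<theta> Q A b c"
  shows "\<exists>y z. kkt x y z"
proof -
  let ?g = "fenchel_conjugate \<theta>"
  have Ax: "A x = b" and fin: "primal_objective \<theta> Q c x < \<infinity>"
    and min: "\<And>u. A u = b \<Longrightarrow> primal_objective \<theta> Q c x \<le> primal_objective \<theta> Q c u"
    using sol by (auto simp: primal_solutions_def solution_set_def is_arg_min_linorder)
  obtain T where T: "?g x = ereal T"
    using fin fenchel_conjugate_not_MInf[OF theta, of x]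
    by (cases "?g x") (auto simp: primal_objective_def)
  note conv = convex_ereal_epigraph_fenchel_conjugate[OF theta]
  define d where "d = Q x + c"
  have lin: "T + d \<bullet> x \<le> r + d \<bullet> u" if u: "?g u \<le> ereal r" "A u = b" for u r
  proof -
    have "T + d \<bullet> x - r - d \<bullet> u \<le> 0"
    proof (rule nonpos_if_le_square)
      fix \<tau> :: real assume \<tau>: "0 < \<tau>" "\<tau> < 1"
      define v where "v = x + \<tau> *\<^sub>R (u - x)"
      have "?g v \<le> ereal (T + \<tau> * (r - T))"
        unfolding v_def using convex_ereal_epigraphD[OF conv, of x T u r \<tau>] u(1) T \<tau> by simp
      then have "primal_objective \<theta> Q c v
          \<le> ereal (T + \<tau> * (r - T)) + ereal (1/2 * (v \<bullet> Q v)) + ereal (c \<bullet> v)"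
        unfolding primal_objective_def by (intro add_right_mono)
      moreover have "A v = b" by (simp add: v_def A.add A.scaleR A.diff Ax u(2))
      ultimately have "primal_objective \<theta> Q c x
          \<le> ereal (T + \<tau> * (r - T)) + ereal (1/2 * (v \<bullet> Q v)) + ereal (c \<bullet> v)"
        using min order_trans by blast
      then have "T + 1/2 * (x \<bullet> Q x) + c \<bullet> x \<le> T + \<tau> * (r - T) + 1/2 * (v \<bullet> Q v) + c \<bullet> v"
        by (simp add: primal_objective_def T)
      moreover have "1/2 * (v \<bullet> Q v) = 1/2 * (x \<bullet> Q x) + \<tau> * (Q x \<bullet> (u - x))
          + \<tau>\<^sup>2 * (1/2 * ((u - x) \<bullet> Q (u - x)))"
        using quadratic_expand[of v x] by (simp add: v_def Q.scaleR power2_eq_square)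
      moreover have "c \<bullet> v = c \<bullet> x + \<tau> * (c \<bullet> (u - x))" by (simp add: v_def inner_add_right)
      moreover have "\<tau> * (T + d \<bullet> x - r - d \<bullet> u) =
          - (\<tau> * (r - T)) - \<tau> * (Q x \<bullet> (u - x)) - \<tau> * (c \<bullet> (u - x))"
        by (simp add: d_def inner_add_left inner_diff_right algebra_simps)
      ultimately show "\<tau> * (T + d \<bullet> x - r - d \<bullet> u) \<le> \<tau>\<^sup>2 * (1/2 * ((u - x) \<bullet> Q (u - x)))"
        by linarith
    qed
    then show ?thesis by simp
  qed
  \<comment> \<open>The epigraph of the conjugate plus the linear function with slope
    \<open>d\<close>. The shear \<open>h\<close> used for its convexity carries it to the epigraph
    of the conjugate itself.\<close>
  define E where "E = {(u, s). ?g u \<le> ereal (s - d \<bullet> u)}"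
  have "convex E"
  proof (rule convexI)
    fix p q :: "'a \<times> real" and u v :: real
    assume p: "p \<in> E" and q: "q \<in> E" and uv: "0 \<le> u" "0 \<le> v" "u + v = 1"
    define h where "h w = (fst w, snd w - d \<bullet> fst w)" for w :: "'a \<times> real"
    have E_iff: "w \<in> E \<longleftrightarrow> h w \<in> ereal_epigraph ?g" for w
      by (cases w) (simp add: E_def h_def ereal_epigraph_def)
    have "u *\<^sub>R h p + v *\<^sub>R h q \<in> ereal_epigraph ?g"
      using p q uv by (intro convexD[OF conv]) (auto simp: E_iff)
    moreover have "u *\<^sub>R h p + v *\<^sub>R h q = h (u *\<^sub>R p + v *\<^sub>R q)"
      by (simp add: h_def inner_add_right algebra_simps)
    ultimately show "u *\<^sub>R p + v *\<^sub>R q \<in> E" by (simp add: E_iff)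
  qed
  have up: "(u, s') \<in> E" if "(u, s) \<in> E" "s \<le> s'" for u s s'
    using that by (auto simp: E_def intro: order_trans)
  have dom: "fst ` E = effective_domain ?g"
  proof
    show "fst ` E \<subseteq> effective_domain ?g"
      by (auto simp: E_def effective_domain_def intro: le_less_trans)
    show "effective_domain ?g \<subseteq> fst ` E"
    proof
      fix u assume "u \<in> effective_domain ?g"
      then obtain r where "?g u = ereal r"
        using fenchel_conjugate_not_MInf[OF theta, of u]
        by (cases "?g u") (auto simp: effective_domain_def)
      then have "(u, r + d \<bullet> u) \<in> E" by (simp add: E_def)
      then show "u \<in> fst ` E" by force
    qed
  qed
  have mem: "(x, T + d \<bullet> x) \<in> E" by (simp add: E_def T)
  have opt: "T + d \<bullet> x \<le> s" if "(u, s) \<in> E" "A u = b" for u s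
    using lin[of u "s - d \<bullet> u"] that by (simp add: E_def)
  have "\<exists>y. \<forall>(u, s)\<in>E. T + d \<bullet> x + y \<bullet> (A u - b) \<le> s"
    by (rule affine_constraint_multiplier[OF linear_A \<open>convex E\<close> up _ ri(2) mem Ax opt])
      (use ri(1) in \<open>simp_all add: dom\<close>)
  then obtain y where y: "\<And>u s. (u, s) \<in> E \<Longrightarrow> T + d \<bullet> x + y \<bullet> (A u - b) \<le> s"
    by fast
  define z where "z = d - adjoint A y"
  have "subgradient \<theta> x (- z)"
  proof (rule subgradient_of_conjugate[OF theta T])
    fix u r assume "?g u \<le> ereal r"
    then have "T + d \<bullet> x + y \<bullet> (A u - b) \<le> r + d \<bullet> u" by (intro y) (simp add: E_def)
    moreover have "y \<bullet> (A u - b) = adjoint A y \<bullet> (u - x)"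
      using adjoint_inner[OF linear_A, of "u - x" y] Ax by (simp add: A.diff inner_commute)
    ultimately show "T + - z \<bullet> (u - x) \<le> r"
      by (simp add: z_def inner_diff_left inner_diff_right)
  qed
  then have "kkt x y z" using Ax by (simp add: kkt_def z_def d_def)
  then show ?thesis by blast
qed

section \<open>Convergence of the relaxed splitting iteration\<close>

text \<open>Here \<open>e\<close> and \<open>g\<close> are the errors of \<open>x\<close> and
  \<open>z\<close>, and \<open>d\<close> is the unrelaxed step. In the application
  \<open>orth\<close> holds because \<open>e + d\<close> lies in the kernel of \<open>A\<close> and
  the other factor in the range of its adjoint.\<close>

lemma relaxed_step_fejer:
  assumes "\<And>u. u \<bullet> Q u \<le> L * (u \<bullet> u)" and "0 < \<sigma>" "0 < \<rho>"
    and orth: "(e + d) \<bullet> (d - \<sigma> *\<^sub>R g + \<sigma> *\<^sub>R Q e) = 0" and mono: "e \<bullet> g \<le> 0"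
  shows "(norm (e - \<sigma> *\<^sub>R g + \<rho> *\<^sub>R d))\<^sup>2
    \<le> (norm (e - \<sigma> *\<^sub>R g))\<^sup>2 - \<rho> * (2 - \<sigma> * L / 2 - \<rho>) * (norm d)\<^sup>2"
proof -
  \<comment> \<open>Completing the square absorbs both \<open>e \<bullet> Q e\<close> and the cross
    term at the cost of a quarter of \<open>d \<bullet> Q d\<close>; this produces the constant
    \<open>\<sigma> * L / 2\<close>.\<close>
  have "0 \<le> ((1/2) *\<^sub>R d + e) \<bullet> Q ((1/2) *\<^sub>R d + e)" by (rule psd_Q)
  also have "\<dots> = (d \<bullet> Q d) / 4 + d \<bullet> Q e + e \<bullet> Q e"
    using sym_Q[of d e]
    by (simp add: Q.add Q.scaleR inner_add_left inner_add_right inner_commute)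
  also have "d \<bullet> Q d \<le> L * (norm d)\<^sup>2" using assms(1)[of d] by (simp add: dot_square_norm)
  finally have "- (L * (norm d)\<^sup>2 / 4) \<le> d \<bullet> Q e + e \<bullet> Q e" by simp
  then have "\<sigma> * - (L * (norm d)\<^sup>2 / 4) \<le> \<sigma> * (d \<bullet> Q e + e \<bullet> Q e)"
    using \<open>0 < \<sigma>\<close> by (intro mult_left_mono) auto
  moreover have "\<sigma> * (e \<bullet> g) \<le> 0" using mono \<open>0 < \<sigma>\<close> by (simp add: mult_le_0_iff)
  moreover have "(e - \<sigma> *\<^sub>R g) \<bullet> d
      = - (norm d)\<^sup>2 - \<sigma> * (d \<bullet> Q e + e \<bullet> Q e) + \<sigma> * (e \<bullet> g)"
    using orth
    by (simp add: inner_add_left inner_add_right inner_diff_left inner_diff_right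
        inner_commute[of g d] dot_square_norm algebra_simps)
  ultimately have "(e - \<sigma> *\<^sub>R g) \<bullet> d \<le> - (norm d)\<^sup>2 + \<sigma> * L * (norm d)\<^sup>2 / 4"
    by simp
  then have "\<rho> * ((e - \<sigma> *\<^sub>R g) \<bullet> d) \<le> \<rho> * (- (norm d)\<^sup>2 + \<sigma> * L * (norm d)\<^sup>2 / 4)"
    using \<open>0 < \<rho>\<close> by (intro mult_left_mono) auto
  moreover have "(norm (e - \<sigma> *\<^sub>R g + \<rho> *\<^sub>R d))\<^sup>2 =
      (norm (e - \<sigma> *\<^sub>R g))\<^sup>2 + 2 * (\<rho> * ((e - \<sigma> *\<^sub>R g) \<bullet> d)) + \<rho>\<^sup>2 * (norm d)\<^sup>2"
    using norm_add_square_expand[of "e - \<sigma> *\<^sub>R g" "\<rho> *\<^sub>R d"] by (simp add: power_mult_distrib)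
  moreover have "2 * (\<rho> * (- (norm d)\<^sup>2 + \<sigma> * L * (norm d)\<^sup>2 / 4)) + \<rho>\<^sup>2 * (norm d)\<^sup>2
      = - (\<rho> * (2 - \<sigma> * L / 2 - \<rho>) * (norm d)\<^sup>2)"
    by (simp add: power2_eq_square field_simps)
  ultimately show ?thesis by linarith
qed

text \<open>The Fejer quantity is the distance of \<open>U\<close> to a KKT value. It controls
  \<open>X\<close>, and its drops control \<open>D\<close>; a cluster point satisfies the KKT
  system, and the Fejer property with respect to that very point upgrades subsequential to full
  convergence.\<close>

lemma relaxed_splitting_converges:
  fixes X Z :: "nat \<Rightarrow> 'a" and Y :: "nat \<Rightarrow> 'b" and \<sigma> \<rho> L :: real
  defines "D \<equiv> \<lambda>k. \<sigma> *\<^sub>R (adjoint A (Y k) + Z k - Q (X k) - c)"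
    and "U \<equiv> \<lambda>k. X k - \<sigma> *\<^sub>R Z k"
  assumes L: "\<And>u. u \<bullet> Q u \<le> L * (u \<bullet> u)"
    and \<sigma>: "0 < \<sigma>" and \<rho>: "0 < \<rho>" "\<rho> < 2 - \<sigma> * L / 2"
    and sub: "\<And>k. subgradient \<theta> (X k) (- Z k)"
    and feas: "\<And>k. A (X k + D k) = b"
    and step: "\<And>k. U (Suc k) = U k + \<rho> *\<^sub>R D k"
    and "\<exists>x y z. kkt x y z"
  shows "\<exists>x y z. kkt x y z \<and> X \<longlonglongrightarrow> x \<and> Y \<longlonglongrightarrow> y \<and> Z \<longlonglongrightarrow> z"
proof -
  define \<kappa> where "\<kappa> = \<rho> * (2 - \<sigma> * L / 2 - \<rho>)"
  have "\<kappa> > 0" using \<rho> by (simp add: \<kappa>_def)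
  have mono: "(X k - x) \<bullet> (Z k - z) \<le> 0" if "kkt x y z" for x y z k
    using subgradient_monotone[OF sub, of x "- z" k] that
    by (simp add: kkt_def inner_diff_right)
  have fejer: "(norm (U (Suc k) - (x - \<sigma> *\<^sub>R z)))\<^sup>2
      \<le> (norm (U k - (x - \<sigma> *\<^sub>R z)))\<^sup>2 - \<kappa> * (norm (D k))\<^sup>2" if k: "kkt x y z" for x y z k
  proof -
    let ?e = "X k - x" and ?g = "Z k - z"
    have Ax: "A x = b" and eq: "z - Q x - c = - adjoint A y"
      using k by (auto simp: kkt_def algebra_simps)
    have "D k - \<sigma> *\<^sub>R ?g + \<sigma> *\<^sub>R Q ?e = \<sigma> *\<^sub>R adjoint A (Y k) + \<sigma> *\<^sub>R (z - Q x - c)"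
      by (simp add: D_def Q.diff algebra_simps)
    also have "\<dots> = adjoint A (\<sigma> *\<^sub>R (Y k - y))"
      unfolding eq by (simp add: A'.scaleR A'.diff algebra_simps)
    finally have "(?e + D k) \<bullet> (D k - \<sigma> *\<^sub>R ?g + \<sigma> *\<^sub>R Q ?e) = A (?e + D k) \<bullet> (\<sigma> *\<^sub>R (Y k - y))"
      by (simp only: adjoint_inner[OF linear_A])
    also have "A (?e + D k) = 0"
      using feas[of k] Ax by (simp add: A.add A.diff algebra_simps)
    finally have "(norm (?e - \<sigma> *\<^sub>R ?g + \<rho> *\<^sub>R D k))\<^sup>2
        \<le> (norm (?e - \<sigma> *\<^sub>R ?g))\<^sup>2 - \<kappa> * (norm (D k))\<^sup>2"
      unfolding \<kappa>_def by (intro relaxed_step_fejer L \<sigma> \<rho>(1) mono[OF k]) simp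
    moreover have "U (Suc k) - (x - \<sigma> *\<^sub>R z) = ?e - \<sigma> *\<^sub>R ?g + \<rho> *\<^sub>R D k"
      unfolding step by (simp add: U_def algebra_simps)
    moreover have "U k - (x - \<sigma> *\<^sub>R z) = ?e - \<sigma> *\<^sub>R ?g"
      by (simp add: U_def algebra_simps)
    ultimately show ?thesis by (simp only:)
  qed
  have decr: "decseq (\<lambda>k. (norm (U k - (x - \<sigma> *\<^sub>R z)))\<^sup>2)" if k: "kkt x y z" for x y z
  proof (rule decseq_SucI)
    fix n
    have "0 \<le> \<kappa> * (norm (D n))\<^sup>2" using \<open>\<kappa> > 0\<close> by simp
    then show "(norm (U (Suc n) - (x - \<sigma> *\<^sub>R z)))\<^sup>2 \<le> (norm (U n - (x - \<sigma> *\<^sub>R z)))\<^sup>2"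
      using fejer[OF k, of n] by linarith
  qed
  have conv: "convergent (\<lambda>k. (norm (U k - (x - \<sigma> *\<^sub>R z)))\<^sup>2)" if k: "kkt x y z" for x y z
    using decseq_convergent[OF decr[OF k], of 0] by (auto intro: convergentI)
  \<comment> \<open>\<open>X k\<close> is the proximal point of the scaled conjugate at
    \<open>U k\<close>; monotonicity makes the cross term in the expansion of \<open>U\<close>
    favorable.\<close>
  have nonexp: "norm (X k - x) \<le> norm (U k - (x - \<sigma> *\<^sub>R z))" if k: "kkt x y z" for x y z k
  proof -
    let ?e = "X k - x" and ?g = "Z k - z"
    have "(norm (?e - \<sigma> *\<^sub>R ?g))\<^sup>2 = (norm ?e)\<^sup>2 - 2 * (\<sigma> * (?e \<bullet> ?g)) + (norm (\<sigma> *\<^sub>R ?g))\<^sup>2"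
      using norm_add_square_expand[of ?e "- (\<sigma> *\<^sub>R ?g)"] by simp
    moreover have "\<sigma> * (?e \<bullet> ?g) \<le> 0" using mono[OF k] \<sigma> by (simp add: mult_le_0_iff)
    ultimately have "(norm ?e)\<^sup>2 \<le> (norm (?e - \<sigma> *\<^sub>R ?g))\<^sup>2" by (smt (verit) zero_le_power2)
    then have "norm ?e \<le> norm (?e - \<sigma> *\<^sub>R ?g)" by (rule power2_le_imp_le) simp
    moreover have "U k - (x - \<sigma> *\<^sub>R z) = ?e - \<sigma> *\<^sub>R ?g" by (simp add: U_def algebra_simps)
    ultimately show ?thesis by (simp only:)
  qed
  obtain x' y' z' where k': "kkt x' y' z'" using assms by blast
  define u' where "u' = x' - \<sigma> *\<^sub>R z'"
  have "D \<longlonglongrightarrow> 0"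
  proof -
    obtain l where l: "(\<lambda>k. (norm (U k - u'))\<^sup>2) \<longlonglongrightarrow> l"
      using conv[OF k'] by (auto simp: convergent_def u'_def)
    \<comment> \<open>Consecutive differences of a convergent sequence vanish, and they dominate the
      squared steps.\<close>
    have "(\<lambda>k. ((norm (U k - u'))\<^sup>2 - (norm (U (Suc k) - u'))\<^sup>2) / \<kappa>) \<longlonglongrightarrow> (l - l) / \<kappa>"
      using l LIMSEQ_Suc[OF l] \<open>\<kappa> > 0\<close> by (intro tendsto_intros) auto
    then have "(\<lambda>k. ((norm (U k - u'))\<^sup>2 - (norm (U (Suc k) - u'))\<^sup>2) / \<kappa>) \<longlonglongrightarrow> 0"
      by simp
    moreover have "(norm (D k))\<^sup>2 \<le> ((norm (U k - u'))\<^sup>2 - (norm (U (Suc k) - u'))\<^sup>2) / \<kappa>" for k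
      using fejer[OF k', of k] \<open>\<kappa> > 0\<close> by (simp add: u'_def field_simps)
    ultimately have "(\<lambda>k. (norm (D k))\<^sup>2) \<longlonglongrightarrow> 0"
      by (intro Lim_null_comparison[where f = "\<lambda>k. (norm (D k))\<^sup>2"]) auto
    then have "(\<lambda>k. sqrt ((norm (D k))\<^sup>2)) \<longlonglongrightarrow> sqrt 0" by (rule tendsto_real_sqrt)
    then show ?thesis by (simp add: tendsto_norm_zero_iff)
  qed
  have bound: "norm (U k - u') \<le> norm (U 0 - u')" for k
    using decseqD[OF decr[OF k'], of 0 k] by (auto simp: u'_def intro: power2_le_imp_le)
  \<comment> \<open>Boundedness of \<open>U\<close> and \<open>X\<close> suffices: \<open>Z\<close>
    is a function of the two, and \<open>adjoint A (Y k)\<close> is recovered from \<open>D\<close>,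
    \<open>Z\<close> and \<open>X\<close>.\<close>
  have "bounded (range (\<lambda>k. (U k, X k)))"
  proof -
    have "(U k, X k) \<in> cball u' (norm (U 0 - u')) \<times> cball x' (norm (U 0 - u'))" for k
      using bound[of k] nonexp[OF k', of k, folded u'_def]
      by (simp add: dist_norm norm_minus_commute[of u'] norm_minus_commute[of x'])
    then have "range (\<lambda>k. (U k, X k)) \<subseteq> cball u' (norm (U 0 - u')) \<times> cball x' (norm (U 0 - u'))"
      by blast
    then show ?thesis by (rule bounded_subset[rotated]) (intro bounded_Times bounded_cball)
  qed
  then obtain l r where r: "strict_mono (r :: nat \<Rightarrow> nat)" and "((\<lambda>k. (U k, X k)) \<circ> r) \<longlonglongrightarrow> l"
    using bounded_imp_convergent_subsequence by blast
  then have "(\<lambda>k. (U (r k), X (r k))) \<longlonglongrightarrow> l" by (simp add: o_def)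
  from tendsto_fst[OF this] tendsto_snd[OF this]
  have Ur: "(\<lambda>k. U (r k)) \<longlonglongrightarrow> fst l" and Xr: "(\<lambda>k. X (r k)) \<longlonglongrightarrow> snd l"
    by simp_all
  have Z_eq: "Z k = (1 / \<sigma>) *\<^sub>R (X k - U k)" for k using \<sigma> by (simp add: U_def)
  define x u z where "x = snd l" and "u = fst l" and "z = (1 / \<sigma>) *\<^sub>R (x - u)"
  have Zr: "(\<lambda>k. Z (r k)) \<longlonglongrightarrow> z"
    unfolding Z_eq z_def x_def u_def by (intro tendsto_intros Ur Xr)
  have Dr: "(\<lambda>k. D (r k)) \<longlonglongrightarrow> 0"
    using LIMSEQ_subseq_LIMSEQ[OF \<open>D \<longlonglongrightarrow> 0\<close> r] by (simp add: o_def)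
  have Q_lim: "(\<lambda>k. Q (f k)) \<longlonglongrightarrow> Q a" if "f \<longlonglongrightarrow> a" for f and a :: 'a
    using bounded_linear.tendsto[OF linear_conv_bounded_linear[THEN iffD1, OF linear_Q]] that .
  have A_lim: "(\<lambda>k. A (f k)) \<longlonglongrightarrow> A a" if "f \<longlonglongrightarrow> a" for f and a :: 'a
    using bounded_linear.tendsto[OF linear_conv_bounded_linear[THEN iffD1, OF linear_A]] that .
  have AY_eq: "adjoint A (Y k) = (1 / \<sigma>) *\<^sub>R D k - Z k + Q (X k) + c" for k
    using \<sigma> by (simp add: D_def)
  have AYr: "(\<lambda>k. adjoint A (Y (r k))) \<longlonglongrightarrow> (1 / \<sigma>) *\<^sub>R 0 - z + Q x + c"
    unfolding AY_eq by (intro tendsto_intros Dr Zr Q_lim) (simp add: x_def Xr)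
  \<comment> \<open>Only \<open>adjoint A (Y (r k))\<close> is known to converge so far; closedness
    of the range provides a preimage \<open>y\<close> of its limit.\<close>
  have "closed (range (adjoint A))"
    by (intro closed_subspace linear_subspace_image linear_adjoint linear_A subspace_UNIV)
  then have "(1 / \<sigma>) *\<^sub>R 0 - z + Q x + c \<in> range (adjoint A)"
    by (rule closed_sequentially[OF _ _ AYr]) simp
  then obtain y where y: "adjoint A y = - z + Q x + c" by force
  have kkt: "kkt x y z"
    unfolding kkt_def
  proof (intro conjI)
    have "(\<lambda>k. A (X (r k) + D (r k))) \<longlonglongrightarrow> A (x + 0)"
      unfolding x_def by (intro A_lim tendsto_intros Xr Dr)
    then show "A x = b" by (simp add: feas LIMSEQ_const_iff)
    show "subgradient \<theta> x (- z)"
      by (rule subgradient_limit[OF theta sub Xr[folded x_def]]) (intro tendsto_intros Zr)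
  qed (simp add: y)
  have u_eq: "x - \<sigma> *\<^sub>R z = u" using \<sigma> by (simp add: z_def)
  have U: "U \<longlonglongrightarrow> u"
  proof -
    \<comment> \<open>The distance to the new KKT value converges, and along the subsequence it
      tends to zero, so its limit is zero.\<close>
    obtain l where l: "(\<lambda>k. (norm (U k - u))\<^sup>2) \<longlonglongrightarrow> l"
      using conv[OF kkt] by (auto simp: convergent_def u_eq)
    have "(\<lambda>k. (norm (U (r k) - u))\<^sup>2) \<longlonglongrightarrow> l"
      using LIMSEQ_subseq_LIMSEQ[OF l r] by (simp add: o_def)
    moreover have "(\<lambda>k. (norm (U (r k) - u))\<^sup>2) \<longlonglongrightarrow> (norm (u - u))\<^sup>2"
      by (intro tendsto_intros) (simp add: u_def Ur)
    ultimately have "l = (norm (u - u))\<^sup>2" by (rule LIMSEQ_unique)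
    with tendsto_real_sqrt[OF l] have "(\<lambda>k. sqrt ((norm (U k - u))\<^sup>2)) \<longlonglongrightarrow> sqrt 0" by simp
    then show ?thesis by (simp add: tendsto_norm_zero_iff LIM_zero_iff)
  qed
  have X: "X \<longlonglongrightarrow> x"
  proof (rule LIM_zero_cancel, rule Lim_null_comparison)
    show "(\<lambda>k. norm (U k - u)) \<longlonglongrightarrow> 0" using U by (simp add: tendsto_norm_zero_iff LIM_zero_iff)
    show "\<forall>\<^sub>F k in sequentially. norm (X k - x) \<le> norm (U k - u)"
      using nonexp[OF kkt] by (simp add: u_eq)
  qed
  have Z: "Z \<longlonglongrightarrow> z"
    unfolding Z_eq z_def by (intro tendsto_intros U X)
  have AY: "(\<lambda>k. adjoint A (Y k)) \<longlonglongrightarrow> adjoint A y"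
  proof -
    have "(\<lambda>k. adjoint A (Y k)) \<longlonglongrightarrow> (1 / \<sigma>) *\<^sub>R 0 - z + Q x + c"
      unfolding AY_eq by (intro tendsto_intros \<open>D \<longlonglongrightarrow> 0\<close> Z Q_lim X)
    then show ?thesis by (simp add: y)
  qed
  \<comment> \<open>The lower bound for the adjoint transfers convergence from
    \<open>adjoint A (Y k)\<close> to \<open>Y k\<close>.\<close>
  obtain m where m: "m > 0" "\<And>y. m * norm y \<le> norm (adjoint A y)"
    using bounded_below_adjoint[OF linear_A surj_A] by blast
  have "Y \<longlonglongrightarrow> y"
  proof (rule LIM_zero_cancel, rule Lim_null_comparison)
    have "(\<lambda>k. norm (adjoint A (Y k) - adjoint A y) / m) \<longlonglongrightarrow> norm (adjoint A y - adjoint A y) / m"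
      using m(1) by (intro tendsto_intros AY) auto
    then show "(\<lambda>k. norm (adjoint A (Y k) - adjoint A y) / m) \<longlonglongrightarrow> 0" by simp
    have "norm (Y k - y) \<le> norm (adjoint A (Y k) - adjoint A y) / m" for k
      using m(2)[of "Y k - y"] m(1) by (simp add: A'.diff field_simps)
    then show "\<forall>\<^sub>F k in sequentially. norm (Y k - y) \<le> norm (adjoint A (Y k) - adjoint A y) / m"
      by simp
  qed
  then show ?thesis using kkt X Z by blast
qed

section \<open>The generalized modified ADMM\<close>

lemma y_optimality_solvable:
  assumes "0 < \<sigma>"
  shows "\<exists>y. A (x + \<sigma> *\<^sub>R (adjoint A y + z - Q w - c)) = b"
proof -
  obtain y where "A (adjoint A y) = (1 / \<sigma>) *\<^sub>R (b - A x) - A (z - Q w - c)"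
    using surj_adjoint[OF linear_A surj_A] by blast
  moreover have "A (x + \<sigma> *\<^sub>R (adjoint A y + z - Q w - c))
      = A x + \<sigma> *\<^sub>R (A (adjoint A y) + A (z - Q w - c))"
    by (simp add: A.add A.diff A.scaleR)
  ultimately show ?thesis using assms by auto
qed

text \<open>With \<open>\<theta> (- z)\<close> finite the objective is a real quadratic in
  \<open>y\<close>, and its exact expansion has gradient
  \<open>A (x + \<sigma> *\<^sub>R r y) - b\<close>.\<close>

lemma y_minimizer_iff:
  assumes "0 < \<sigma>" and t: "\<theta> (- z) = ereal t"
  shows "y_minimizer \<theta> Q A b c \<sigma> w z x y
    \<longleftrightarrow> A (x + \<sigma> *\<^sub>R (adjoint A y + z - Q w - c)) = b" (is "?min y \<longleftrightarrow> ?opt y")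
proof -
  define r where "r y = adjoint A y + z - Q w - c" for y
  define q where "q y = 1/2 * (w \<bullet> Q w) - b \<bullet> y + t + r y \<bullet> x + \<sigma>/2 * (norm (r y))\<^sup>2" for y
  have min_iff: "?min y \<longleftrightarrow> (\<forall>y'. q y \<le> q y')" for y
    by (simp add: y_minimizer_def is_arg_min_linorder aug_lagrangian_def t q_def r_def)
  have expand: "q y' = q y + (A (x + \<sigma> *\<^sub>R r y) - b) \<bullet> (y' - y)
      + \<sigma>/2 * (norm (adjoint A (y' - y)))\<^sup>2" for y y'
  proof -
    let ?h = "adjoint A (y' - y)"
    have r: "r y' = r y + ?h" by (simp add: r_def A'.diff)
    have "\<sigma>/2 * (norm (r y'))\<^sup>2 = \<sigma>/2 * (norm (r y))\<^sup>2 + \<sigma> * (r y \<bullet> ?h) + \<sigma>/2 * (norm ?h)\<^sup>2"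
      by (simp only: r norm_add_square_expand) (simp add: distrib_left)
    moreover have "A (x + \<sigma> *\<^sub>R r y) \<bullet> (y' - y) = x \<bullet> ?h + \<sigma> * (r y \<bullet> ?h)"
      by (simp only: adjoint_inner[OF linear_A] inner_add_left inner_scaleR_left)
    moreover have "r y' \<bullet> x = r y \<bullet> x + x \<bullet> ?h"
      by (simp only: r inner_add_left inner_commute[of x])
    ultimately show ?thesis by (simp add: q_def inner_diff_left[of _ b] inner_diff_right[of b])
  qed
  have opt_min: "q y + \<sigma>/2 * (norm (adjoint A (y' - y)))\<^sup>2 = q y'" if "?opt y" for y y'
    using expand[of y' y] that by (simp add: r_def)
  show ?thesis
  proof
    assume opt: "?opt y"
    have "0 \<le> \<sigma>/2 * (norm (adjoint A (y' - y)))\<^sup>2" for y' using \<open>0 < \<sigma>\<close> by simp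
    then have "q y \<le> q y'" for y' unfolding opt_min[OF opt, of y', symmetric] by simp
    then show "?min y" by (simp add: min_iff)
  next
    assume min: "?min y"
    \<comment> \<open>Comparison with a solution of the optimality equation forces the remainder to
      vanish, so \<open>adjoint A y\<close> and \<open>adjoint A y\<^sub>0\<close> agree; the
      equation depends on \<open>y\<close> only through this value.\<close>
    obtain y\<^sub>0 where "?opt y\<^sub>0"
      using y_optimality_solvable[OF \<open>0 < \<sigma>\<close>] by blast
    moreover have "q y \<le> q y\<^sub>0" using min by (simp add: min_iff)
    ultimately have "\<sigma>/2 * (norm (adjoint A (y - y\<^sub>0)))\<^sup>2 \<le> 0" using opt_min[of y\<^sub>0 y] by linarith
    then have "adjoint A (y - y\<^sub>0) = 0" using \<open>0 < \<sigma>\<close> by (simp add: mult_le_0_iff)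
    then have "adjoint A y = adjoint A y\<^sub>0" by (simp add: A'.diff)
    then show "?opt y" using \<open>?opt y\<^sub>0\<close> by simp
  qed
qed

lemma y_minimizer_exists:
  assumes "0 < \<sigma>" and t: "\<theta> (- z) = ereal t"
  shows "\<exists>y. y_minimizer \<theta> Q A b c \<sigma> w z x y"
  using y_optimality_solvable[OF assms(1)] y_minimizer_iff[OF assms] by blast

lemma relaxed_residual_eq:
  "relaxed_residual Q A c \<rho> w y zold z
    = (\<rho> *\<^sub>R adjoint A y - (1 - \<rho>) *\<^sub>R zold - \<rho> *\<^sub>R Q w - \<rho> *\<^sub>R c) + z"
  by (simp add: relaxed_residual_def)

lemma z_minimizer_iff:
  assumes "0 < \<sigma>"
  shows "z_minimizer \<theta> Q A c \<sigma> \<rho> w y zold x z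
    \<longleftrightarrow> subgradient \<theta> (x + \<sigma> *\<^sub>R relaxed_residual Q A c \<rho> w y zold z) (- z)"
  unfolding z_minimizer_def relaxed_residual_eq by (rule prox_argmin_iff[OF theta assms])

text \<open>The conjugate is finite at a solution \<open>p\<close> of (P), which supplies the affine
  minorant of \<theta> with slope \<open>p\<close>.\<close>

lemma z_minimizer_exists:
  assumes "0 < \<sigma>" and "primal_solutions \<theta> Q A b c \<noteq> {}"
  shows "\<exists>z. z_minimizer \<theta> Q A c \<sigma> \<rho> w y zold x z"
proof -
  obtain p where "primal_objective \<theta> Q c p < \<infinity>"
    using assms(2) by (auto simp: primal_solutions_def solution_set_def)
  then obtain m where m: "fenchel_conjugate \<theta> p = ereal m"
    using fenchel_conjugate_not_MInf[OF theta, of p]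
    by (cases "fenchel_conjugate \<theta> p") (auto simp: primal_objective_def)
  then have "p \<bullet> u - m \<le> r" if "\<theta> u \<le> ereal r" for u r
    using fenchel_conjugate_le_iff[OF theta, THEN iffD1, rule_format, of p m u r] that by simp
  then show ?thesis
    unfolding z_minimizer_def relaxed_residual_eq by (rule prox_argmin_exists[OF theta assms(1)])
qed

lemma z_minimizer_finite:
  assumes "0 < \<sigma>" "z_minimizer \<theta> Q A c \<sigma> \<rho> w y zold x z"
  shows "\<exists>t. \<theta> (- z) = ereal t"
  using assms by (auto simp: z_minimizer_iff subgradient_def)

lemma gmadmm_upto_finite:
  assumes "0 < \<sigma>" and "- z0 \<in> effective_domain \<theta>"
    and run: "gmadmm_upto n \<theta> Q A b c \<sigma> \<rho> z0 x0 w y z x"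
  shows "\<exists>t. \<theta> (- z n) = ereal t"
proof (cases n)
  case 0
  then have "\<theta> (- z n) < \<infinity>"
    using assms(2) run by (simp add: gmadmm_upto_def effective_domain_def)
  then show ?thesis using closed_proper_convexD(1)[OF theta, of "- z n"] by (cases "\<theta> (- z n)") auto
next
  case (Suc k)
  then show ?thesis using run z_minimizer_finite[OF assms(1)] by (auto simp: gmadmm_upto_def)
qed

lemma gmadmm_iff:
  "gmadmm \<theta> Q A b c \<sigma> \<rho> z0 x0 w y z x \<longleftrightarrow>
     z 0 = z0 \<and> x 0 = x0 \<and>
     (\<forall>k. w (Suc k) = x k \<and>
            y_minimizer \<theta> Q A b c \<sigma> (w (Suc k)) (z k) (x k) (y (Suc k)) \<and>
            z_minimizer \<theta> Q A c \<sigma> \<rho> (w (Suc k)) (y (Suc k)) (z k) (x k) (z (Suc k)) \<and>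
            x (Suc k) = x k + \<sigma> *\<^sub>R relaxed_residual Q A c \<rho> (w (Suc k)) (y (Suc k)) (z k) (z (Suc k)))"
  unfolding gmadmm_def gmadmm_upto_def by blast

text \<open>Dependent choice, with finiteness of \<open>\<theta> (- z)\<close> as the invariant that
  keeps the next \<open>y\<close>-subproblem solvable.\<close>

lemma gmadmm_exists:
  assumes "0 < \<sigma>" and "primal_solutions \<theta> Q A b c \<noteq> {}" and z0: "- z0 \<in> effective_domain \<theta>"
  shows "\<exists>w y z x. gmadmm \<theta> Q A b c \<sigma> \<rho> z0 x0 w y z x"
proof -
  define P where "P n s \<longleftrightarrow> (case s of (w :: 'a, y :: 'b, z, x) \<Rightarrow>
      (\<exists>t. \<theta> (- z) = ereal t) \<and> (n = 0 \<longrightarrow> z = z0 \<and> x = x0))" for n :: nat and s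
  define R where "R s s' \<longleftrightarrow> (case s of (w :: 'a, y :: 'b, z, x) \<Rightarrow> case s' of (w', y', z', x') \<Rightarrow>
      w' = x \<and> y_minimizer \<theta> Q A b c \<sigma> w' z x y' \<and> z_minimizer \<theta> Q A c \<sigma> \<rho> w' y' z x z' \<and>
      x' = x + \<sigma> *\<^sub>R relaxed_residual Q A c \<rho> w' y' z z')" for s s'
  have "\<exists>f. \<forall>n. P n (f n) \<and> R (f n) (f (Suc n))"
  proof (rule dependent_nat_choice)
    have "\<exists>t. \<theta> (- z0) = ereal t"
      using z0 closed_proper_convexD(1)[OF theta, of "- z0"]
      by (cases "\<theta> (- z0)") (auto simp: effective_domain_def)
    \<comment> \<open>The zeros fill the arbitrary entries \<open>w 0\<close> and
      \<open>y 0\<close>.\<close>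
    then have "P 0 (0, 0, z0, x0)" by (simp add: P_def)
    then show "\<exists>s. P 0 s" by blast
  next
    fix s n assume s: "P n s"
    obtain w y z x where s_eq: "s = (w, y, z, x)" by (cases s)
    obtain t where "\<theta> (- z) = ereal t" using s by (auto simp: s_eq P_def)
    then obtain y' where y': "y_minimizer \<theta> Q A b c \<sigma> x z x y'"
      using y_minimizer_exists[OF assms(1)] by blast
    obtain z' where z': "z_minimizer \<theta> Q A c \<sigma> \<rho> x y' z x z'"
      using z_minimizer_exists[OF assms(1,2)] by blast
    define s' where "s' = (x, y', z', x + \<sigma> *\<^sub>R relaxed_residual Q A c \<rho> x y' z z')"
    have "P (Suc n) s' \<and> R s s'"
      using y' z' z_minimizer_finite[OF assms(1) z'] by (simp add: P_def R_def s_eq s'_def)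
    then show "\<exists>s'. P (Suc n) s' \<and> R s s'" by blast
  qed
  then obtain f where P: "\<And>n. P n (f n)" and R: "\<And>n. R (f n) (f (Suc n))" by blast
  have "gmadmm \<theta> Q A b c \<sigma> \<rho> z0 x0 (\<lambda>n. fst (f n)) (\<lambda>n. fst (snd (f n)))
      (\<lambda>n. fst (snd (snd (f n)))) (\<lambda>n. snd (snd (snd (f n))))"
    unfolding gmadmm_iff using P[of 0] R unfolding P_def R_def split_beta by blast
  then show ?thesis by blast
qed

text \<open>From its second iterate on, the method is the relaxed Davis--Yin iteration; the first
  iterate need not satisfy \<open>x 0 \<in> \<partial>\<theta> (- z 0)\<close>, hence the index shift.\<close>

lemma gmadmm_converges:
  assumes L: "\<And>u. u \<bullet> Q u \<le> L * (u \<bullet> u)"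
    and \<sigma>: "0 < \<sigma>" and \<rho>: "0 < \<rho>" "\<rho> < 2 - \<sigma> * L / 2"
    and kkt: "\<exists>x y z. kkt x y z"
    and run: "gmadmm \<theta> Q A b c \<sigma> \<rho> z0 x0 w y z x"
  shows "\<exists>x' y' z'. kkt x' y' z' \<and> x \<longlonglongrightarrow> x' \<and> y \<longlonglongrightarrow> y' \<and> z \<longlonglongrightarrow> z' \<and> w \<longlonglongrightarrow> x'"
proof -
  have w: "w (Suc k) = x k"
    and y_min: "y_minimizer \<theta> Q A b c \<sigma> (x k) (z k) (x k) (y (Suc k))"
    and z_min: "z_minimizer \<theta> Q A c \<sigma> \<rho> (x k) (y (Suc k)) (z k) (x k) (z (Suc k))"
    and x: "x (Suc k) = x k + \<sigma> *\<^sub>R relaxed_residual Q A c \<rho> (x k) (y (Suc k)) (z k) (z (Suc k))"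
    for k
    using run unfolding gmadmm_iff by metis+
  \<comment> \<open>The subgradient in the \<open>z\<close>-optimality condition is exactly the
    updated \<open>x\<close>.\<close>
  have sub: "subgradient \<theta> (x (Suc k)) (- z (Suc k))" for k
    using z_min[of k] unfolding z_minimizer_iff[OF \<sigma>] x .
  \<comment> \<open>The state with index \<open>Suc k\<close> is paired with the
    \<open>y\<close>-iterate computed from it, which has index \<open>Suc (Suc k)\<close>.\<close>
  have feas: "A (x (Suc k) + \<sigma> *\<^sub>R (adjoint A (y (Suc (Suc k))) + z (Suc k) - Q (x (Suc k)) - c)) = b"
    for k
  proof -
    obtain t where "\<theta> (- z (Suc k)) = ereal t" using z_minimizer_finite[OF \<sigma> z_min] by blast
    from y_minimizer_iff[OF \<sigma> this] show ?thesis using y_min by blast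
  qed
  \<comment> \<open>The new \<open>z\<close> cancels, and the term with \<open>1 - \<rho>\<close>
    combines with \<open>z k\<close> so that \<rho> multiplies the whole residual.\<close>
  have step: "x (Suc k) - \<sigma> *\<^sub>R z (Suc k) = x k - \<sigma> *\<^sub>R z k
      + \<rho> *\<^sub>R (\<sigma> *\<^sub>R (adjoint A (y (Suc k)) + z k - Q (x k) - c))" for k
    unfolding x relaxed_residual_def by (simp add: algebra_simps)
  obtain x' y' z' where lim: "kkt x' y' z'" "(\<lambda>k. x (Suc k)) \<longlonglongrightarrow> x'"
    "(\<lambda>k. y (Suc (Suc k))) \<longlonglongrightarrow> y'" "(\<lambda>k. z (Suc k)) \<longlonglongrightarrow> z'"
    using relaxed_splitting_converges[of L \<sigma> \<rho> "\<lambda>k. x (Suc k)" "\<lambda>k. z (Suc k)" "\<lambda>k. y (Suc (Suc k))",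
        OF L \<sigma> \<rho> sub feas step kkt] by blast
  then have "x \<longlonglongrightarrow> x'" "z \<longlonglongrightarrow> z'"
    by (simp_all only: filterlim_sequentially_Suc)
  moreover have "y \<longlonglongrightarrow> y'"
    by (intro LIMSEQ_imp_Suc[of y] LIMSEQ_imp_Suc[of "\<lambda>k. y (Suc k)"] lim(3))
  moreover have "w \<longlonglongrightarrow> x'"
    using \<open>x \<longlonglongrightarrow> x'\<close> by (subst filterlim_sequentially_Suc[symmetric]) (simp add: w)
  ultimately show ?thesis using lim(1) by blast
qed

end

theorem theorem2:
  fixes \<theta> :: "'a::euclidean_space \<Rightarrow> ereal"
    and Q :: "'a \<Rightarrow> 'a" and A :: "'a \<Rightarrow> 'b::real_inner"
    and b :: 'b and c :: 'a and \<sigma> \<rho> :: real and z0 x0 :: 'a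
  assumes "closed_proper_convex \<theta>"
    and "linear Q" and "\<forall>u v. Q u \<bullet> v = u \<bullet> Q v" and "\<forall>u. 0 \<le> u \<bullet> Q u"
    and "linear A" and "surj A"
    and "\<exists>x \<in> rel_interior (effective_domain (fenchel_conjugate \<theta>)). A x = b"
    and "primal_solutions \<theta> Q A b c \<noteq> {}"
    and "0 < \<sigma>" and "ereal \<sigma> < sigma_bound Q"
    and "0 < \<rho>" and "\<rho> < (4 - \<sigma> * lambda_max Q) / 2"
    and "- z0 \<in> effective_domain \<theta>"
  shows "(\<forall>n w y z x. gmadmm_upto n \<theta> Q A b c \<sigma> \<rho> z0 x0 w y z x \<longrightarrow>
            (\<exists>y'. y_minimizer \<theta> Q A b c \<sigma> (x n) (z n) (x n) y') \<and>
            (\<forall>y'. y_minimizer \<theta> Q A b c \<sigma> (x n) (z n) (x n) y' \<longrightarrow>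
                  (\<exists>z'. z_minimizer \<theta> Q A c \<sigma> \<rho> (x n) y' (z n) (x n) z')))
       \<and> (\<exists>w y z x. gmadmm \<theta> Q A b c \<sigma> \<rho> z0 x0 w y z x)
       \<and> (\<forall>w y z x. gmadmm \<theta> Q A b c \<sigma> \<rho> z0 x0 w y z x \<longrightarrow>
            (\<exists>s \<in> dual_solutions \<theta> Q A b c. (\<lambda>k. (w k, y k, z k)) \<longlonglongrightarrow> s) \<and>
            (\<exists>s \<in> primal_solutions \<theta> Q A b c. x \<longlonglongrightarrow> s))"
proof -
  interpret composite_problem \<theta> Q A b c
    by (rule composite_problem.intro) (use assms(1-6) in blast)+
  note \<sigma> = assms(9)
  \<comment> \<open>Solvability holds at every state reached by a finite run, whichever minimizers
    were picked; the \<open>z\<close>-subproblem is solvable for every \<open>y'\<close>.\<close>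
  have steps: "(\<exists>y'. y_minimizer \<theta> Q A b c \<sigma> (x n) (z n) (x n) y') \<and>
      (\<forall>y'. \<exists>z'. z_minimizer \<theta> Q A c \<sigma> \<rho> (x n) y' (z n) (x n) z')"
    if "gmadmm_upto n \<theta> Q A b c \<sigma> \<rho> z0 x0 w y z x" for n w y z x
    using gmadmm_upto_finite[OF \<sigma> assms(13) that] y_minimizer_exists[OF \<sigma>]
      z_minimizer_exists[OF \<sigma> assms(8)] by blast
  obtain \<xi> where \<xi>: "\<xi> \<in> rel_interior (effective_domain (fenchel_conjugate \<theta>))" "A \<xi> = b"
    using assms(7) by blast
  obtain xbar where "xbar \<in> primal_solutions \<theta> Q A b c" using assms(8) by blast
  then have kkt: "\<exists>x y z. kkt x y z" using kkt_exists[OF \<xi>] by blast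
  have L: "u \<bullet> Q u \<le> lambda_max Q * (u \<bullet> u)" for u
    by (rule inner_le_lambda_max[OF linear_Q sym_Q])
  \<comment> \<open>The upper bound on \<rho>, rewritten as positivity of the coefficient in the
    Fejer estimate.\<close>
  have \<rho>: "\<rho> < 2 - \<sigma> * lambda_max Q / 2" using assms(12) by (simp add: field_simps)
  have conv: "(\<exists>s \<in> dual_solutions \<theta> Q A b c. (\<lambda>k. (w k, y k, z k)) \<longlonglongrightarrow> s) \<and>
      (\<exists>s \<in> primal_solutions \<theta> Q A b c. x \<longlonglongrightarrow> s)"
    if run: "gmadmm \<theta> Q A b c \<sigma> \<rho> z0 x0 w y z x" for w y z x
  proof -
    obtain x' y' z' where lim: "kkt x' y' z'" "x \<longlonglongrightarrow> x'" "y \<longlonglongrightarrow> y'" "z \<longlonglongrightarrow> z'" "w \<longlonglongrightarrow> x'"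
      using gmadmm_converges[OF L \<sigma> assms(11) \<rho> kkt run] by blast
    then have "(\<lambda>k. (w k, y k, z k)) \<longlonglongrightarrow> (x', y', z')" by (intro tendsto_Pair)
    then show ?thesis
      using kkt_imp_dual_solution[OF lim(1)] kkt_imp_primal_solution[OF lim(1)] lim(2) by blast
  qed
  show ?thesis
    using steps gmadmm_exists[OF \<sigma> assms(8,13)] conv by blast
qed

end
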